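(* Let $\bar M$ be a real submanifold of $\mathbb{C}P^n$ of real dimension $\bar m$ such that $\bar J\bar H$ is tangent to $\bar M$. Assume that $\bar M$ has non-zero constant mean curvature $|\bar H|$. Then: (a) If $\bar M$ is proper-biharmonic, then $|\bar H|^2\in\left(0,\frac{\bar m+3}{\bar m}\right]$. (b) If $|\bar H|^2=\frac{\bar m+3}{\bar m}$, then $\bar M$ is proper-biharmonic if and only if it is pseudo-umbilical and $\nabla^\perp\bar H=0$.
   Context: $\mathbb{C}P^n$ carries the Fubini-Study metric $\langle\cdot,\cdot\rangle$ of constant holomorphic sectional curvature $4$; $\bar J$ is its complex structure. $\bar H=\frac{1}{\bar m}\operatorname{trace}\bar B$ is the mean curvature vector field of $\bar M$ (with $\bar B$ the second fundamental form), and $\nabla^\perp$ is the normal connection. $\bar M$ is pseudo-umbilical if the Weingarten operator satisfies $\bar A_{\bar H}=|\bar H|^2\,\mathrm{Id}$. A map $\varphi:(M,g)\to(N,h)$ is biharmonic if $\tau_2(\varphi)=-\Delta^{\varphi}\tau(\varphi)-\operatorname{trace}R^N(d\varphi,\tau(\varphi))d\varphi=0$, where $\tau(\varphi)=\operatorname{trace}\nabla d\varphi$, $\Delta^\varphi=-\operatorname{trace}(\nabla^\varphi)^2$ and $R^N(X,Y)Z=\nabla_X\nabla_YZ-\nabla_Y\nabla_XZ-\nabla_{[X,Y]}Z$; it is proper-biharmonic if moreover it is not harmonic ($\tau(\varphi)\not\equiv0$). A submanifold is (proper-)biharmonic if its inclusion map, with the induced metric, is so. *)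

theory Defs
  imports "HOL-Analysis.Analysis" "HOL-Library.Countable_Set"
begin

section \<open>Smooth maps and Riemannian geometry in coordinates\<close>

abbreviation dderiv :: "('a::real_normed_vector \<Rightarrow> 'b::real_normed_vector) \<Rightarrow> 'a \<Rightarrow> 'a \<Rightarrow> 'b"
  where "dderiv f x v \<equiv> frechet_derivative f (at x) v"

(* Only meant for open S in finite dimension: there, continuity of all directional derivatives is
   the same as continuity of the derivative. *)
primrec Ck_on :: "nat \<Rightarrow> ('a::euclidean_space \<Rightarrow> 'b::euclidean_space) \<Rightarrow> 'a set \<Rightarrow> bool" where
  "Ck_on 0 f S \<longleftrightarrow> continuous_on S f"
| "Ck_on (Suc k) f S \<longleftrightarrow>
     f differentiable_on S \<and> (\<forall>v. Ck_on k (\<lambda>x. dderiv f x v) S)"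

definition smooth_on :: "('a::euclidean_space \<Rightarrow> 'b::euclidean_space) \<Rightarrow> 'a set \<Rightarrow> bool" where
  "smooth_on f S \<longleftrightarrow> (\<forall>k. Ck_on k f S)"

(* A Riemannian metric on an open subset of a Euclidean space: "g x u v" is the inner product of
   the tangent vectors u and v at x. *)
type_synonym 'a metric_field = "'a \<Rightarrow> 'a \<Rightarrow> 'a \<Rightarrow> real"

(* The Christoffel symbols in invariant form: "christoffel g x u v" is the covariant derivative at x,
   for the Levi-Civita connection of g, of the constant field v in direction u.  The defining
   equation is the Koszul formula for constant vector fields. *)
definition christoffel :: "'a::euclidean_space metric_field \<Rightarrow> 'a \<Rightarrow> 'a \<Rightarrow> 'a \<Rightarrow> 'a" where
  "christoffel g x u v =
     (THE c. \<forall>w. 2 * g x c w =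
        dderiv (\<lambda>y. g y v w) x u + dderiv (\<lambda>y. g y u w) x v - dderiv (\<lambda>y. g y u v) x w)"

definition levi_civita :: "'b::euclidean_space metric_field \<Rightarrow> ('b \<Rightarrow> 'b) \<Rightarrow> 'b \<Rightarrow> 'b \<Rightarrow> 'b" where
  "levi_civita h Y y u = dderiv Y y u + christoffel h y u (Y y)"

(* R(X,Y)Z with R(X,Y) = [nabla_X, nabla_Y] - nabla_[X,Y]; the constant fields X, Y commute. *)
definition riemann_curv :: "'b::euclidean_space metric_field \<Rightarrow> 'b \<Rightarrow> 'b \<Rightarrow> 'b \<Rightarrow> 'b \<Rightarrow> 'b" where
  "riemann_curv h y X Y Z =
     levi_civita h (\<lambda>q. levi_civita h (\<lambda>_. Z) q Y) y X
   - levi_civita h (\<lambda>q. levi_civita h (\<lambda>_. Z) q X) y Y"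

(* The pull-back connection: derivative in direction u of a vector field V along f. *)
definition cov_along ::
  "'b::euclidean_space metric_field \<Rightarrow> ('a::euclidean_space \<Rightarrow> 'b) \<Rightarrow> ('a \<Rightarrow> 'b) \<Rightarrow> 'a \<Rightarrow> 'a \<Rightarrow> 'b"
  where
  "cov_along h f V x u = dderiv V x u + christoffel h (f x) (dderiv f x u) (V x)"

(* Trace of a bilinear map b with respect to an inner product a: the sum of a^{ij} b_{ij}. *)
definition metric_trace ::
  "(real^'m \<Rightarrow> real^'m \<Rightarrow> real) \<Rightarrow> (real^'m \<Rightarrow> real^'m \<Rightarrow> 'b::real_vector) \<Rightarrow> 'b" where
  "metric_trace a b =
     (\<Sum>i\<in>UNIV. \<Sum>j\<in>UNIV.
        (matrix_inv (\<chi> k l. a (axis k 1) (axis l 1)) $ i $ j) *\<^sub>R b (axis i 1) (axis j 1))"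


section \<open>Biharmonic maps\<close>

(* The second fundamental form (nabla df)(u,v) of a map f. *)
definition hessian_map ::
  "'a::euclidean_space metric_field \<Rightarrow> 'b::euclidean_space metric_field \<Rightarrow> ('a \<Rightarrow> 'b) \<Rightarrow>
   'a \<Rightarrow> 'a \<Rightarrow> 'a \<Rightarrow> 'b" where
  "hessian_map g h f x u v =
     cov_along h f (\<lambda>y. dderiv f y v) x u - dderiv f x (levi_civita g (\<lambda>_. v) x u)"

definition tension ::
  "(real^'m) metric_field \<Rightarrow> 'b::euclidean_space metric_field \<Rightarrow> (real^'m \<Rightarrow> 'b) \<Rightarrow> real^'m \<Rightarrow> 'b" where
  "tension g h f x = metric_trace (g x) (hessian_map g h f x)"

definition rough_laplacian ::
  "(real^'m) metric_field \<Rightarrow> 'b::euclidean_space metric_field \<Rightarrow> (real^'m \<Rightarrow> 'b) \<Rightarrow>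
   (real^'m \<Rightarrow> 'b) \<Rightarrow> real^'m \<Rightarrow> 'b" where
  "rough_laplacian g h f V x =
     - metric_trace (g x) (\<lambda>u v.
         cov_along h f (\<lambda>y. cov_along h f V y v) x u
         - cov_along h f V x (levi_civita g (\<lambda>_. v) x u))"

definition bitension ::
  "(real^'m) metric_field \<Rightarrow> 'b::euclidean_space metric_field \<Rightarrow> (real^'m \<Rightarrow> 'b) \<Rightarrow> real^'m \<Rightarrow> 'b" where
  "bitension g h f x =
     - rough_laplacian g h f (tension g h f) x
     - metric_trace (g x) (\<lambda>u v.
         riemann_curv h (f x) (dderiv f x u) (tension g h f x) (dderiv f x v))"


section \<open>Extrinsic geometry of an immersion\<close>

definition induced_metric ::
  "'b::euclidean_space metric_field \<Rightarrow> ('a::euclidean_space \<Rightarrow> 'b) \<Rightarrow> 'a metric_field" where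
  "induced_metric h f x u v = h (f x) (dderiv f x u) (dderiv f x v)"

definition tangent_space :: "('a::euclidean_space \<Rightarrow> 'b::euclidean_space) \<Rightarrow> 'a \<Rightarrow> 'b set" where
  "tangent_space f x = range (dderiv f x)"

definition tangential_part ::
  "'b::euclidean_space metric_field \<Rightarrow> ('a::euclidean_space \<Rightarrow> 'b) \<Rightarrow> 'a \<Rightarrow> 'b \<Rightarrow> 'b" where
  "tangential_part h f x V =
     (THE t. t \<in> tangent_space f x \<and> (\<forall>s\<in>tangent_space f x. h (f x) (V - t) s = 0))"

definition normal_part ::
  "'b::euclidean_space metric_field \<Rightarrow> ('a::euclidean_space \<Rightarrow> 'b) \<Rightarrow> 'a \<Rightarrow> 'b \<Rightarrow> 'b" where
  "normal_part h f x V = V - tangential_part h f x V"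

definition second_fund_form ::
  "'b::euclidean_space metric_field \<Rightarrow> ('a::euclidean_space \<Rightarrow> 'b) \<Rightarrow> 'a \<Rightarrow> 'a \<Rightarrow> 'a \<Rightarrow> 'b" where
  "second_fund_form h f x u v = normal_part h f x (cov_along h f (\<lambda>y. dderiv f y v) x u)"

definition mean_curv ::
  "'b::euclidean_space metric_field \<Rightarrow> (real^'m \<Rightarrow> 'b) \<Rightarrow> real^'m \<Rightarrow> 'b" where
  "mean_curv h f x =
     (1 / real CARD('m)) *\<^sub>R metric_trace (induced_metric h f x) (second_fund_form h f x)"

(* For a normal field \<xi>, the Weingarten formula splits the ambient derivative of \<xi> in direction
   u into its tangential part - A_\<xi> u and its normal part nabla^perp_u \<xi>.  The value A_\<xi> u is
   given as a vector of the ambient tangent space, i.e. as df(A_\<xi> u). *)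
definition weingarten ::
  "'b::euclidean_space metric_field \<Rightarrow> ('a::euclidean_space \<Rightarrow> 'b) \<Rightarrow> ('a \<Rightarrow> 'b) \<Rightarrow> 'a \<Rightarrow> 'a \<Rightarrow> 'b"
  where
  "weingarten h f \<xi> x u = - tangential_part h f x (cov_along h f \<xi> x u)"

definition normal_connection ::
  "'b::euclidean_space metric_field \<Rightarrow> ('a::euclidean_space \<Rightarrow> 'b) \<Rightarrow> ('a \<Rightarrow> 'b) \<Rightarrow> 'a \<Rightarrow> 'a \<Rightarrow> 'b"
  where
  "normal_connection h f \<xi> x u = normal_part h f x (cov_along h f \<xi> x u)"


section \<open>Complex projective space\<close>

(* The n + 1 homogeneous coordinates are indexed by 'n option, where n = CARD('n). *)
type_synonym 'n cp_point = "(complex^('n option)) set"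

definition complex_line :: "complex^('n option) \<Rightarrow> 'n::finite cp_point" where
  "complex_line z = range (\<lambda>c. c *s z)"

definition CP :: "'n::finite cp_point set" where
  "CP = {complex_line z | z. z \<noteq> 0}"

(* The standard affine parametrisations onto {[z]. z_i \<noteq> 0}.  The homogeneous coordinate i is set
   to 1; the others are the components of w, where for i = Some k the component w_k is placed at
   position None. *)
definition affine_param :: "'n option \<Rightarrow> complex^'n \<Rightarrow> 'n::finite cp_point" where
  "affine_param i w =
     complex_line (\<chi> j. if j = i then 1 else if j = None then w $ the i else w $ the j)"

definition affine_coord :: "'n option \<Rightarrow> 'n::finite cp_point \<Rightarrow> complex^'n" where
  "affine_coord i = inv (affine_param i)"

definition hermitian :: "complex^'n \<Rightarrow> complex^'n \<Rightarrow> complex" where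
  "hermitian u v = (\<Sum>k\<in>UNIV. u $ k * cnj (v $ k))"

(* The Fubini-Study metric of constant holomorphic sectional curvature 4,
     ds^2 = |dw|^2 / (1 + |w|^2) - |<dw,w>|^2 / (1 + |w|^2)^2,
   polarised.  It has this same expression in each of the affine charts, since the changes of
   homogeneous coordinates between them are unitary (permutations). *)
definition fubini_study :: "(complex^'n) metric_field" where
  "fubini_study w u v =
     Re (hermitian u v) / (1 + (norm w)\<^sup>2)
     - Re (hermitian u w * hermitian w v) / (1 + (norm w)\<^sup>2)\<^sup>2"

(* The affine charts are holomorphic, so the complex structure is multiplication by i in each. *)
definition complex_structure :: "complex^'n \<Rightarrow> complex^'n" where
  "complex_structure v = \<i> *s v"


section \<open>Real submanifolds of complex projective space\<close>

(* A local parametrisation: an open domain together with a map from it into the manifold. *)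
type_synonym ('m, 'n) cp_patch = "(real^'m) set \<times> (real^'m \<Rightarrow> 'n cp_point)"

(* The coordinate expressions of the inclusion into CP^n: one for each local parametrisation of the
   submanifold and each affine chart of CP^n, on the set where both are defined. *)
definition inclusion_reps ::
  "('m::finite, 'n::finite) cp_patch set \<Rightarrow> ((real^'m) set \<times> (real^'m \<Rightarrow> complex^'n)) set" where
  "inclusion_reps A =
     {({x \<in> U. \<psi> x \<in> range (affine_param i)}, \<lambda>x. affine_coord i (\<psi> x)) | U \<psi> i. (U, \<psi>) \<in> A}"

(* M, with the smooth structure given by the atlas A, is a real submanifold of CP^n of dimension
   CARD('m): the inclusion is an immersion for that structure.  It is not required to be an
   embedding; embedded submanifolds are the case where the patches are homeomorphisms onto
   relatively open subsets of M.  The Hausdorff property is inherited from CP^n, and the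
   countable subatlas expresses second countability. *)
definition cp_submanifold ::
  "'n::finite cp_point set \<Rightarrow> ('m::finite, 'n) cp_patch set \<Rightarrow> bool" where
  "cp_submanifold M A \<longleftrightarrow>
     M \<noteq> {} \<and> M \<subseteq> CP \<and> M = (\<Union>(U, \<psi>)\<in>A. \<psi> ` U) \<and>
     (\<exists>A'\<subseteq>A. countable A' \<and> M = (\<Union>(U, \<psi>)\<in>A'. \<psi> ` U)) \<and>
     (\<forall>(U, \<psi>)\<in>A. open U \<and> inj_on \<psi> U) \<and>
     (\<forall>(U, \<psi>)\<in>A. \<forall>(V, \<theta>)\<in>A.
        open {x \<in> U. \<psi> x \<in> \<theta> ` V} \<and>
        smooth_on (\<lambda>x. inv_into V \<theta> (\<psi> x)) {x \<in> U. \<psi> x \<in> \<theta> ` V}) \<and>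
     (\<forall>(W, f)\<in>inclusion_reps A.
        open W \<and> smooth_on f W \<and> (\<forall>x\<in>W. inj (dderiv f x)))"

(* Each of the following conditions at a point is independent of coordinates; it is asked for in
   every coordinate expression of the inclusion around every point of the submanifold. *)

definition harmonic_submanifold :: "('m::finite, 'n::finite) cp_patch set \<Rightarrow> bool" where
  "harmonic_submanifold A \<longleftrightarrow>
     (\<forall>(W, f)\<in>inclusion_reps A. \<forall>x\<in>W.
        tension (induced_metric fubini_study f) fubini_study f x = 0)"

definition biharmonic_submanifold :: "('m::finite, 'n::finite) cp_patch set \<Rightarrow> bool" where
  "biharmonic_submanifold A \<longleftrightarrow>
     (\<forall>(W, f)\<in>inclusion_reps A. \<forall>x\<in>W.
        bitension (induced_metric fubini_study f) fubini_study f x = 0)"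

definition proper_biharmonic_submanifold :: "('m::finite, 'n::finite) cp_patch set \<Rightarrow> bool" where
  "proper_biharmonic_submanifold A \<longleftrightarrow> biharmonic_submanifold A \<and> \<not> harmonic_submanifold A"

definition fs_norm :: "complex^'n \<Rightarrow> complex^'n \<Rightarrow> real" where
  "fs_norm w v = sqrt (fubini_study w v v)"

definition constant_mean_curvature :: "('m::finite, 'n::finite) cp_patch set \<Rightarrow> real \<Rightarrow> bool" where
  "constant_mean_curvature A c \<longleftrightarrow>
     (\<forall>(W, f)\<in>inclusion_reps A. \<forall>x\<in>W. fs_norm (f x) (mean_curv fubini_study f x) = c)"

definition JH_tangent :: "('m::finite, 'n::finite) cp_patch set \<Rightarrow> bool" where
  "JH_tangent A \<longleftrightarrow>
     (\<forall>(W, f)\<in>inclusion_reps A. \<forall>x\<in>W.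
        complex_structure (mean_curv fubini_study f x) \<in> tangent_space f x)"

definition pseudo_umbilical :: "('m::finite, 'n::finite) cp_patch set \<Rightarrow> bool" where
  "pseudo_umbilical A \<longleftrightarrow>
     (\<forall>(W, f)\<in>inclusion_reps A. \<forall>x\<in>W. \<forall>u.
        weingarten fubini_study f (mean_curv fubini_study f) x u =
        (fs_norm (f x) (mean_curv fubini_study f x))\<^sup>2 *\<^sub>R dderiv f x u)"

definition parallel_mean_curvature :: "('m::finite, 'n::finite) cp_patch set \<Rightarrow> bool" where
  "parallel_mean_curvature A \<longleftrightarrow>
     (\<forall>(W, f)\<in>inclusion_reps A. \<forall>x\<in>W. \<forall>u.
        normal_connection fubini_study f (mean_curv fubini_study f) x u = 0)"

end

theory Submission
  imports Defs
begin

text \<open>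
  Let \<open>h\<close> be the Fubini-Study metric, \<open>\<nabla>\<close> the connection along the immersion \<open>f\<close>, \<open>m\<close> the dimension
  of the submanifold and \<open>\<tau> = m H\<close> the tension field of \<open>f\<close>, where \<open>H\<close> is the mean curvature vector.

  The curvature of \<open>h\<close> is explicit, and if \<open>J\<tau>\<close> is tangent it gives
  \<open>trace R(df, \<tau>) df = - (m + 3) \<tau>\<close> (lemma \<open>curvature_trace\<close>).  Biharmonicity is thus the eigenvalue
  equation \<open>\<Delta>\<tau> = (m + 3) \<tau>\<close> (\<open>bitension_eq\<close>).  If moreover \<open>T = h(\<tau>, \<tau>)\<close> is constant, differentiating
  it twice gives \<open>h(\<Delta>\<tau>, \<tau>) = |\<nabla>\<tau>|\<^sup>2\<close> (\<open>laplacian_inner_tau\<close>), hence \<open>|\<nabla>\<tau>|\<^sup>2 = (m + 3) T\<close>.  Since \<open>\<tau>\<close> is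
  normal, the trace of \<open>h(\<nabla>\<tau>, df)\<close> is \<open>- h(\<tau>, trace \<nabla>df) = - T\<close> (\<open>trace_weingarten\<close>).

  Consider the field \<open>L = \<nabla>\<tau> + (T/m) df\<close> of linear maps.  Its tangential part vanishes exactly when the
  submanifold is pseudo-umbilical, and its normal part exactly when \<open>H\<close> is parallel in the normal
  bundle.  The three values above combine to \<open>|L|\<^sup>2 = (m + 3) T - T\<^sup>2/m\<close> (\<open>trace_umbilicity_defect\<close>).
  As \<open>T = m\<^sup>2 c\<^sup>2\<close>, the inequality \<open>|L|\<^sup>2 \<ge> 0\<close> is the bound in (a), and in the case of equality \<open>L = 0\<close>,
  which is one direction of (b).  Conversely, if \<open>L = 0\<close> and \<open>T/m = m + 3\<close>, then
  \<open>\<nabla>\<tau> = - (m + 3) df\<close>; differentiating once more, \<open>\<Delta>\<tau> = (m + 3) trace \<nabla>df = (m + 3) \<tau>\<close>.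

  In coordinates, the argument rests on three supports.  The tension field has to be differentiated
  twice, and it is built from the inverse matrix of the induced metric, so smooth functions have to be
  closed under products, reciprocals and, by Cramer's rule, matrix inversion.  Traces, defined by the
  inverse matrix in the coordinate basis, become sums over an orthonormal basis.  The Christoffel
  symbols, defined by the Koszul formula, are identified: for \<open>h\<close> by a closed formula, and for the
  induced metric as the tangential part of \<open>\<nabla>df\<close>, so that \<open>\<tau>\<close> is normal and equals \<open>m H\<close>.
\<close>

section \<open>Smooth functions on open sets\<close>

lemma dderiv_eqI: "(f has_derivative f') (at x) \<Longrightarrow> dderiv f x v = f' v"
  using frechet_derivative_at by metis

lemma has_derivative_dderiv:
  "f differentiable_on S \<Longrightarrow> open S \<Longrightarrow> x \<in> S \<Longrightarrow> (f has_derivative dderiv f x) (at x)"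
  by (metis differentiable_on_eq_differentiable_at frechet_derivative_works)

lemma dderiv_transform:
  assumes "open S" "x \<in> S" "\<And>y. y \<in> S \<Longrightarrow> f y = g y"
  shows "frechet_derivative f (at x) = frechet_derivative g (at x)"
proof -
  have "(f has_derivative f') (at x) \<longleftrightarrow> (g has_derivative f') (at x)" for f'
    using assms has_derivative_transform_within_open[of f f' x UNIV S g]
      has_derivative_transform_within_open[of g f' x UNIV S f] by auto
  then show ?thesis unfolding frechet_derivative_def by simp
qed

lemma Ck_on_cong:
  assumes "open S" "\<And>x. x \<in> S \<Longrightarrow> f x = g x"
  shows "Ck_on k f S = Ck_on k g S"
  using assms(2)
proof (induction k arbitrary: f g)
  case 0
  then show ?case by (simp cong: continuous_on_cong)
next
  case (Suc k)
  have "dderiv f x = dderiv g x" if "x \<in> S" for x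
    using dderiv_transform assms(1) that Suc.prems by blast
  then have "Ck_on k (\<lambda>x. dderiv f x v) S = Ck_on k (\<lambda>x. dderiv g x v) S" for v
    by (intro Suc.IH) simp
  moreover have "f differentiable_on S \<longleftrightarrow> g differentiable_on S"
    using Suc.prems by (metis differentiable_on_def differentiable_transform_within zero_less_one)
  ultimately show ?case by simp
qed

lemma Ck_on_Suc_imp: "Ck_on (Suc k) f S \<Longrightarrow> Ck_on k f S"
proof (induction k arbitrary: f)
  case 0
  then show ?case by (simp add: differentiable_imp_continuous_on)
next
  case (Suc k)
  from Suc.prems have 1: "f differentiable_on S" and 2: "\<And>v. Ck_on (Suc k) (\<lambda>x. dderiv f x v) S"
    unfolding Ck_on.simps(2)[of "Suc k"] by blast+
  show ?case unfolding Ck_on.simps(2)[of k] using 1 Suc.IH[OF 2] by blast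
qed

lemma Ck_on_const: "Ck_on k (\<lambda>x. a) S"
  by (induction k arbitrary: a) auto

lemma Ck_on_linear:
  assumes "open S" "bounded_linear L" "Ck_on k f S"
  shows "Ck_on k (\<lambda>x. L (f x)) S"
  using assms(3)
proof (induction k arbitrary: f)
  case 0
  then show ?case using bounded_linear.continuous_on[OF assms(2)] by auto
next
  case (Suc k)
  have D: "((\<lambda>x. L (f x)) has_derivative (\<lambda>v. L (dderiv f x v))) (at x)" if "x \<in> S" for x
    using Suc.prems that assms(1) 
    by (auto intro!: bounded_linear.has_derivative[OF assms(2)] has_derivative_dderiv)
  have "(\<lambda>x. L (f x)) differentiable_on S"
    using D assms(1) by (meson differentiable_def differentiable_on_eq_differentiable_at)
  moreover have "Ck_on k (\<lambda>x. dderiv (\<lambda>x. L (f x)) x v) S" for v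
    using Suc.IH[of "\<lambda>x. dderiv f x v"] Suc.prems dderiv_eqI[OF D] 
      Ck_on_cong[OF assms(1), of "\<lambda>x. dderiv (\<lambda>x. L (f x)) x v" "\<lambda>x. L (dderiv f x v)"] by simp
  ultimately show ?case by simp
qed

lemma Ck_on_add:
  assumes "open S" "Ck_on k f S" "Ck_on k g S"
  shows "Ck_on k (\<lambda>x. f x + g x) S"
  using assms(2,3)
proof (induction k arbitrary: f g)
  case 0
  then show ?case by (auto intro: continuous_intros)
next
  case (Suc k)
  have D: "((\<lambda>x. f x + g x) has_derivative (\<lambda>v. dderiv f x v + dderiv g x v)) (at x)" if "x \<in> S" for x
    using Suc.prems that assms(1) 
    by (auto intro!: has_derivative_add has_derivative_dderiv)
  have "(\<lambda>x. f x + g x) differentiable_on S"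
    using D assms(1) by (meson differentiable_def differentiable_on_eq_differentiable_at)
  moreover have "Ck_on k (\<lambda>x. dderiv (\<lambda>x. f x + g x) x v) S" for v
    using Suc.IH[of "\<lambda>x. dderiv f x v" "\<lambda>x. dderiv g x v"] Suc.prems dderiv_eqI[OF D] 
      Ck_on_cong[OF assms(1), of "\<lambda>x. dderiv (\<lambda>x. f x + g x) x v" "\<lambda>x. dderiv f x v + dderiv g x v"] by simp
  ultimately show ?case by simp
qed

text \<open>
  Every product below is an instance: of reals, of scalars and vectors, of the Hermitian form.  The
  induction closes because the product rule expresses the derivative by products of functions that are
  one order less smooth.
\<close>

lemma Ck_on_bilinear:
  assumes "open S" "bounded_bilinear B" "Ck_on k f S" "Ck_on k g S"
  shows "Ck_on k (\<lambda>x. B (f x) (g x)) S"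
  using assms(3,4)
proof (induction k arbitrary: f g)
  case 0
  then show ?case using bounded_bilinear.continuous_on[OF assms(2)] by auto
next
  case (Suc k)
  have D: "((\<lambda>x. B (f x) (g x)) has_derivative (\<lambda>v. B (f x) (dderiv g x v) + B (dderiv f x v) (g x))) (at x)"
    if "x \<in> S" for x
    using Suc.prems that assms(1) 
    by (auto intro!: bounded_bilinear.FDERIV[OF assms(2)] has_derivative_dderiv)
  have "(\<lambda>x. B (f x) (g x)) differentiable_on S"
    using D assms(1) by (meson differentiable_def differentiable_on_eq_differentiable_at)
  moreover have "Ck_on k (\<lambda>x. B (f x) (dderiv g x v) + B (dderiv f x v) (g x)) S" for v
    using Suc.prems Ck_on_Suc_imp[OF Suc.prems(1)] Ck_on_Suc_imp[OF Suc.prems(2)]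
    by (intro Ck_on_add assms(1) Suc.IH) auto
  then have "Ck_on k (\<lambda>x. dderiv (\<lambda>x. B (f x) (g x)) x v) S" for v
    using dderiv_eqI[OF D] 
      Ck_on_cong[OF assms(1), of "\<lambda>x. dderiv (\<lambda>x. B (f x) (g x)) x v"
        "\<lambda>x. B (f x) (dderiv g x v) + B (dderiv f x v) (g x)"] by simp
  ultimately show ?case by simp
qed

lemma Ck_on_inverse:
  fixes f :: "'a::euclidean_space \<Rightarrow> real"
  assumes "open S" "Ck_on k f S" "\<And>x. x \<in> S \<Longrightarrow> f x \<noteq> 0"
  shows "Ck_on k (\<lambda>x. inverse (f x)) S"
  using assms(2)
proof (induction k)
  case 0
  then show ?case using assms(3) by (auto intro: continuous_intros)
next
  case (Suc k)
  let ?g = "\<lambda>v x. - (inverse (f x) * dderiv f x v * inverse (f x))"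
  have D: "((\<lambda>x. inverse (f x)) has_derivative (\<lambda>v. ?g v x)) (at x)"
    if "x \<in> S" for x
    using Deriv.has_derivative_inverse[of f, OF assms(3)[OF that] has_derivative_dderiv[OF _ assms(1) that]] Suc.prems
    by simp
  have "(\<lambda>x. inverse (f x)) differentiable_on S"
    using D assms(1) by (meson differentiable_def differentiable_on_eq_differentiable_at)
  moreover have "Ck_on k (?g v) S" for v
  proof -
    have "Ck_on k (\<lambda>x. inverse (f x)) S" using Suc Ck_on_Suc_imp by blast
    then show ?thesis using Suc.prems
    by (intro Ck_on_linear[OF assms(1) bounded_linear_minus[OF bounded_linear_ident]] 
       Ck_on_bilinear[OF assms(1) bounded_bilinear_mult]) auto
  qed
  then have "Ck_on k (\<lambda>x. dderiv (\<lambda>x. inverse (f x)) x v) S" for v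
    using dderiv_eqI[OF D] 
      Ck_on_cong[OF assms(1), of "\<lambda>x. dderiv (\<lambda>x. inverse (f x)) x v" "?g v"] by simp
  ultimately show ?case by simp
qed

lemma smooth_on_cong:
  "open S \<Longrightarrow> (\<And>x. x \<in> S \<Longrightarrow> f x = g x) \<Longrightarrow> smooth_on f S = smooth_on g S"
  unfolding smooth_on_def using Ck_on_cong by blast

lemma smooth_on_const: "smooth_on (\<lambda>x. a) S"
  by (simp add: smooth_on_def Ck_on_const)

lemma smooth_on_linear: "open S \<Longrightarrow> bounded_linear L \<Longrightarrow> smooth_on f S \<Longrightarrow> smooth_on (\<lambda>x. L (f x)) S"
  by (simp add: smooth_on_def Ck_on_linear)

lemma smooth_on_add: "open S \<Longrightarrow> smooth_on f S \<Longrightarrow> smooth_on g S \<Longrightarrow> smooth_on (\<lambda>x. f x + g x) S"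
  by (simp add: smooth_on_def Ck_on_add)

lemma smooth_on_minus: "open S \<Longrightarrow> smooth_on f S \<Longrightarrow> smooth_on (\<lambda>x. - f x) S"
  by (rule smooth_on_linear[OF _ bounded_linear_minus[OF bounded_linear_ident]])

lemma smooth_on_diff: "open S \<Longrightarrow> smooth_on f S \<Longrightarrow> smooth_on g S \<Longrightarrow> smooth_on (\<lambda>x. f x - g x) S"
  using smooth_on_add[of S f "\<lambda>x. - g x"] by (simp add: smooth_on_minus)

lemma smooth_on_bilinear:
  "open S \<Longrightarrow> bounded_bilinear B \<Longrightarrow> smooth_on f S \<Longrightarrow> smooth_on g S \<Longrightarrow> smooth_on (\<lambda>x. B (f x) (g x)) S"
  by (simp add: smooth_on_def Ck_on_bilinear)

lemma smooth_on_inverse: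
  fixes f :: "'a::euclidean_space \<Rightarrow> real"
  shows "open S \<Longrightarrow> smooth_on f S \<Longrightarrow> (\<And>x. x \<in> S \<Longrightarrow> f x \<noteq> 0) \<Longrightarrow> smooth_on (\<lambda>x. inverse (f x)) S"
  by (simp add: smooth_on_def Ck_on_inverse)

lemma smooth_on_dderiv: "smooth_on f S \<Longrightarrow> smooth_on (\<lambda>x. dderiv f x v) S"
  unfolding smooth_on_def by (metis Ck_on.simps(2))

lemma smooth_on_differentiable: "smooth_on f S \<Longrightarrow> f differentiable_on S"
  unfolding smooth_on_def by (metis Ck_on.simps(2))

lemma smooth_on_continuous: "smooth_on f S \<Longrightarrow> continuous_on S f"
  unfolding smooth_on_def by (metis Ck_on.simps(1))

lemma smooth_on_has_derivative:
  "smooth_on f S \<Longrightarrow> open S \<Longrightarrow> x \<in> S \<Longrightarrow> (f has_derivative dderiv f x) (at x)"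
  by (rule has_derivative_dderiv[OF smooth_on_differentiable])

lemma smooth_on_sum:
  assumes "open S" "\<And>i. i \<in> I \<Longrightarrow> smooth_on (f i) S"
  shows "smooth_on (\<lambda>x. \<Sum>i\<in>I. f i x) S"
  using assms by (induction I rule: infinite_finite_induct) (auto intro: smooth_on_const smooth_on_add)

lemma smooth_on_prod:
  fixes f :: "'i \<Rightarrow> 'a::euclidean_space \<Rightarrow> real"
  assumes "open S" "\<And>i. i \<in> I \<Longrightarrow> smooth_on (f i) S"
  shows "smooth_on (\<lambda>x. \<Prod>i\<in>I. f i x) S"
  using assms by (induction I rule: infinite_finite_induct)
    (auto intro: smooth_on_const smooth_on_bilinear[OF _ bounded_bilinear_mult])

lemma smooth_on_det:
  fixes G :: "'a::euclidean_space \<Rightarrow> real^'m^'m"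
  assumes "open S" "\<And>i j. smooth_on (\<lambda>x. G x $ i $ j) S"
  shows "smooth_on (\<lambda>x. det (G x)) S"
  unfolding det_def using assms
  by (intro smooth_on_sum smooth_on_bilinear[OF _ bounded_bilinear_mult] smooth_on_const smooth_on_prod) auto

lemma matrix_inv_works:
  fixes A :: "real^'m^'m"
  assumes "det A \<noteq> 0"
  shows "A ** matrix_inv A = mat 1" "matrix_inv A ** A = mat 1"
proof -
  have "\<exists>B. A ** B = mat 1 \<and> B ** A = mat 1"
    using assms invertible_det_nz[of A] unfolding invertible_def by blast
  from someI_ex[OF this] show "A ** matrix_inv A = mat 1" "matrix_inv A ** A = mat 1"
    unfolding matrix_inv_def by auto
qed

text \<open>
  Cramer's rule writes the entries of the inverse as rational functions of the entries of \<open>A\<close>, which is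
  what makes the inverse of a smooth family of matrices smooth.
\<close>

lemma matrix_inv_cramer:
  fixes A :: "real^'m^'m"
  assumes "det A \<noteq> 0"
  shows "matrix_inv A $ k $ l = det (\<chi> i j. if j = k then axis l 1 $ i else A $ i $ j) / det A"
proof -
  have "A *v (matrix_inv A *v axis l 1) = axis l 1"
    by (simp add: matrix_vector_mul_assoc matrix_inv_works(1)[OF assms])
  then have "matrix_inv A *v axis l 1 = (\<chi> k. det(\<chi> i j. if j=k then axis l 1$i else A$i$j) / det A)"
    using cramer[OF assms] by blast
  moreover have "(matrix_inv A *v axis l 1) $ k = matrix_inv A $ k $ l"
    by (simp add: matrix_vector_mult_basis column_def)
  ultimately show ?thesis by simp
qed

lemma smooth_on_matrix_inv:
  fixes G :: "'a::euclidean_space \<Rightarrow> real^'m^'m"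
  assumes "open S" "\<And>i j. smooth_on (\<lambda>x. G x $ i $ j) S" "\<And>x. x \<in> S \<Longrightarrow> det (G x) \<noteq> 0"
  shows "smooth_on (\<lambda>x. matrix_inv (G x) $ k $ l) S"
proof -
  have "smooth_on (\<lambda>x. det (\<chi> i j. if j = k then axis l 1 $ i else G x $ i $ j) * inverse (det (G x))) S"
  proof -
    have "smooth_on (\<lambda>x. (\<chi> i j. if j = k then axis l 1 $ i else G x $ i $ j) $ i $ j) S" for i j
      using assms(2) by (cases "j = k") (simp_all add: smooth_on_const)
    then show ?thesis using assms
      by (intro smooth_on_bilinear[OF _ bounded_bilinear_mult] smooth_on_det smooth_on_inverse) auto
  qed
  then show ?thesis
    by (rule smooth_on_cong[THEN iffD1, OF assms(1), rotated])
      (simp add: matrix_inv_cramer[OF assms(3)] divide_inverse)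
qed

text \<open>
  The second difference on the parallelogram spanned by \<open>t u\<close> and \<open>t v\<close> is symmetric in \<open>u\<close> and \<open>v\<close>, while
  the mean value theorem, applied first along \<open>u\<close> and then along \<open>v\<close>, turns it into a mixed derivative at
  some point of the parallelogram.
\<close>

lemma second_difference_mean_value:
  fixes f :: "'a::euclidean_space \<Rightarrow> real"
  assumes "f differentiable_on S" "(\<lambda>y. dderiv f y u) differentiable_on S" "open S"
    and "0 < t" and S: "\<And>r s. r \<in> {0..t} \<Longrightarrow> s \<in> {0..t} \<Longrightarrow> x + r *\<^sub>R u + s *\<^sub>R v \<in> S"
  obtains r s where "r \<in> {0..t}" "s \<in> {0..t}"
    "f (x + t *\<^sub>R u + t *\<^sub>R v) - f (x + t *\<^sub>R u) - f (x + t *\<^sub>R v) + f x =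
      t * t * dderiv (\<lambda>y. dderiv f y u) (x + r *\<^sub>R u + s *\<^sub>R v) v"
proof -
  let ?g = "\<lambda>r. f (x + r *\<^sub>R u + t *\<^sub>R v) - f (x + r *\<^sub>R u)"
  have lin: "dderiv f y (c *\<^sub>R w) = c * dderiv f y w" if "y \<in> S" for y c w
    using linear_frechet_derivative[of f "at y"] that assms(1,3) 
    by (simp add: differentiable_on_eq_differentiable_at linear_cmul)
  have lin2: "dderiv (\<lambda>y. dderiv f y u) y (c *\<^sub>R w) = c * dderiv (\<lambda>y. dderiv f y u) y w" if "y \<in> S" for y c w
    using linear_frechet_derivative[of "\<lambda>y. dderiv f y u" "at y"] that assms(2,3) 
    by (simp add: differentiable_on_eq_differentiable_at linear_cmul)
  have S0: "x + r *\<^sub>R u \<in> S" if "r \<in> {0..t}" for r using S[OF that, of 0] \<open>0 < t\<close> by simp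
  have "(?g has_derivative (\<lambda>d. d * (dderiv f (x + r *\<^sub>R u + t *\<^sub>R v) u - dderiv f (x + r *\<^sub>R u) u)))
         (at r within {0..t})" if "r \<in> {0..t}" for r
  proof -
    have *: "((\<lambda>r. x + r *\<^sub>R u + t *\<^sub>R v) has_derivative (\<lambda>d. d *\<^sub>R u)) (at r within {0..t})"
      "((\<lambda>r. x + r *\<^sub>R u) has_derivative (\<lambda>d. d *\<^sub>R u)) (at r within {0..t})"
      by (auto intro!: derivative_eq_intros)
    have S1: "x + r *\<^sub>R u + t *\<^sub>R v \<in> S" using S[OF that, of t] \<open>0 < t\<close> by simp
    show ?thesis
      using has_derivative_diff[OF has_derivative_compose[OF *(1) has_derivative_dderiv[OF assms(1,3) S1]]
        has_derivative_compose[OF *(2) has_derivative_dderiv[OF assms(1,3) S0[OF that]]]]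
      by (simp add: lin S1 S0[OF that] right_diff_distrib)
  qed
  from mvt_simple[OF \<open>0 < t\<close> this[OF atLeastAtMost_iff[THEN iffD2, OF conjI]]] obtain r where r0: "r \<in> {0<..<t}"
    "?g t - ?g 0 = (t - 0) * (dderiv f (x + r *\<^sub>R u + t *\<^sub>R v) u - dderiv f (x + r *\<^sub>R u) u)"
    by blast
  then have r: "r \<in> {0..t}" by simp
  let ?k = "\<lambda>s. dderiv f (x + r *\<^sub>R u + s *\<^sub>R v) u"
  have "(?k has_derivative (\<lambda>d. d * dderiv (\<lambda>y. dderiv f y u) (x + r *\<^sub>R u + s *\<^sub>R v) v))
         (at s within {0..t})" if "s \<in> {0..t}" for s
  proof -
    have *: "((\<lambda>s. x + r *\<^sub>R u + s *\<^sub>R v) has_derivative (\<lambda>d. d *\<^sub>R v)) (at s within {0..t})"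
      by (auto intro!: derivative_eq_intros)
    show ?thesis
      using has_derivative_compose[OF * has_derivative_dderiv[OF assms(2,3) S[OF r that]]]
      by (simp add: lin2 S[OF r that])
  qed
  from mvt_simple[OF \<open>0 < t\<close> this[OF atLeastAtMost_iff[THEN iffD2, OF conjI]]] obtain s where s0: "s \<in> {0<..<t}"
    "?k t - ?k 0 = (t - 0) * dderiv (\<lambda>y. dderiv f y u) (x + r *\<^sub>R u + s *\<^sub>R v) v"
    by blast
  show thesis using that[OF r, of s] r0(2) s0 by (simp add: algebra_simps)
qed

text \<open>
  Letting \<open>t\<close> tend to 0 in the second difference, evaluated in both orders, brings the two mixed
  derivatives together at \<open>x\<close> by continuity.
\<close>

lemma second_derivative_symmetric_real:
  fixes f :: "'a::euclidean_space \<Rightarrow> real"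
  assumes "smooth_on f S" "open S" "x \<in> S"
  shows "dderiv (\<lambda>y. dderiv f y u) x v = dderiv (\<lambda>y. dderiv f y v) x u"
proof (rule ccontr)
  let ?P = "\<lambda>y. dderiv (\<lambda>y. dderiv f y u) y v" and ?Q = "\<lambda>y. dderiv (\<lambda>y. dderiv f y v) y u"
  assume ne: "?P x \<noteq> ?Q x"
  define e where "e = \<bar>?P x - ?Q x\<bar> / 2"
  have e: "e > 0" using ne by (simp add: e_def)
  have "isCont ?P x" "isCont ?Q x"
    using assms smooth_on_dderiv smooth_on_continuous continuous_on_eq_continuous_at by blast+
  then obtain d1 d2 where d: "d1 > 0" "d2 > 0" 
     "\<And>y. dist y x < d1 \<Longrightarrow> dist (?P y) (?P x) < e" "\<And>y. dist y x < d2 \<Longrightarrow> dist (?Q y) (?Q x) < e"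
    using e unfolding continuous_at_eps_delta by metis
  obtain d3 where d3: "d3 > 0" "ball x d3 \<subseteq> S" using assms(2,3) open_contains_ball by blast
  define d where "d = min d1 (min d2 d3)"
  have "d > 0" using d(1,2) d3 by (simp add: d_def)
  \<comment> \<open>this size keeps the parallelogram inside the ball of radius d around x\<close>
  define q where "q = norm u + norm v + 1"
  define t where "t = d / 2 / q"
  have npos: "q > 0" unfolding q_def by (smt (verit) norm_ge_zero)
  have t: "t > 0" using npos \<open>d > 0\<close> by (simp add: t_def)
  have near: "dist (x + r *\<^sub>R u + s *\<^sub>R v) x < d" if "r \<in> {0..t}" "s \<in> {0..t}" for r s
  proof -
    have "dist (x + r *\<^sub>R u + s *\<^sub>R v) x \<le> norm (r *\<^sub>R u) + norm (s *\<^sub>R v)" 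
      using norm_triangle_ineq[of "r *\<^sub>R u" "s *\<^sub>R v"] by (simp add: dist_norm add.assoc)
    also have "\<dots> \<le> t * norm u + t * norm v" using that by (auto intro!: add_mono mult_right_mono)
    also have "\<dots> \<le> t * q" using t by (simp add: q_def algebra_simps)
    also have "\<dots> = d / 2" using npos by (simp add: t_def)
    finally show ?thesis using \<open>d > 0\<close> by simp
  qed
  then have inS: "x + r *\<^sub>R u + s *\<^sub>R v \<in> S" if "r \<in> {0..t}" "s \<in> {0..t}" for r s
    using that d3 by (fastforce simp: d_def dist_commute)
  have inS': "x + r *\<^sub>R v + s *\<^sub>R u \<in> S" if "r \<in> {0..t}" "s \<in> {0..t}" for r s
    using inS[OF that(2,1)] by (simp add: ac_simps)
  have dif: "f differentiable_on S" "\<And>u. (\<lambda>y. dderiv f y u) differentiable_on S"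
    using assms(1) smooth_on_differentiable smooth_on_dderiv by blast+
  obtain r s where rs: "r \<in> {0..t}" "s \<in> {0..t}"
    "f (x + t *\<^sub>R u + t *\<^sub>R v) - f (x + t *\<^sub>R u) - f (x + t *\<^sub>R v) + f x =
      t * t * ?P (x + r *\<^sub>R u + s *\<^sub>R v)"
    using second_difference_mean_value[OF dif(1) dif(2) assms(2) t inS] by metis
  obtain r' s' where rs': "r' \<in> {0..t}" "s' \<in> {0..t}"
    "f (x + t *\<^sub>R v + t *\<^sub>R u) - f (x + t *\<^sub>R v) - f (x + t *\<^sub>R u) + f x =
      t * t * ?Q (x + r' *\<^sub>R v + s' *\<^sub>R u)"
    using second_difference_mean_value[OF dif(1) dif(2) assms(2) t inS'] by metis
  have "t * t * ?P (x + r *\<^sub>R u + s *\<^sub>R v) = t * t * ?Q (x + r' *\<^sub>R v + s' *\<^sub>R u)"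
    using rs(3) rs'(3) by (simp only: add.assoc add.commute[of "t *\<^sub>R v"])
  then have eq: "?P (x + r *\<^sub>R u + s *\<^sub>R v) = ?Q (x + r' *\<^sub>R v + s' *\<^sub>R u)" using t by simp
  have "dist (?P (x + r *\<^sub>R u + s *\<^sub>R v)) (?P x) < e"
    using near[OF rs(1,2)] by (intro d) (simp add: d_def)
  moreover have "dist (?Q (x + r' *\<^sub>R v + s' *\<^sub>R u)) (?Q x) < e"
    using near[OF rs'(2,1)] by (intro d) (simp add: d_def ac_simps)
  ultimately show False using eq by (simp add: e_def dist_real_def abs_if split: if_splits)
qed

lemma second_derivative_symmetric:
  fixes f :: "'a::euclidean_space \<Rightarrow> 'b::euclidean_space"
  assumes "smooth_on f S" "open S" "x \<in> S"
  shows "dderiv (\<lambda>y. dderiv f y u) x v = dderiv (\<lambda>y. dderiv f y v) x u"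
proof (rule euclidean_eqI)
  fix b :: 'b
  have sm: "smooth_on (\<lambda>y. f y \<bullet> b) S"
    by (rule smooth_on_linear[OF assms(2) bounded_linear_inner_left assms(1)])
  have 1: "dderiv (\<lambda>y. f y \<bullet> b) y w = dderiv f y w \<bullet> b" if "y \<in> S" for y w
    using smooth_on_has_derivative[OF assms(1,2) that]
    by (intro dderiv_eqI) (auto intro!: derivative_eq_intros)
  have 2: "dderiv (\<lambda>y. dderiv (\<lambda>y. f y \<bullet> b) y u) x v = dderiv (\<lambda>y. dderiv f y u) x v \<bullet> b" for u v
  proof -
    have "dderiv (\<lambda>y. dderiv (\<lambda>y. f y \<bullet> b) y u) x = dderiv (\<lambda>y. dderiv f y u \<bullet> b) x"
      by (rule dderiv_transform[OF assms(2,3)]) (simp add: 1)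
    moreover have "dderiv (\<lambda>y. dderiv f y u \<bullet> b) x v = dderiv (\<lambda>y. dderiv f y u) x v \<bullet> b"
      using smooth_on_has_derivative[OF smooth_on_dderiv[OF assms(1)] assms(2,3)]
      by (intro dderiv_eqI) (auto intro!: derivative_eq_intros)
    ultimately show ?thesis by simp
  qed
  show "dderiv (\<lambda>y. dderiv f y u) x v \<bullet> b = dderiv (\<lambda>y. dderiv f y v) x u \<bullet> b"
    using second_derivative_symmetric_real[OF sm assms(2,3)] by (simp add: 2)
qed

section \<open>Traces with respect to an inner product\<close>

locale inner_form =
  fixes a :: "real^'m \<Rightarrow> real^'m \<Rightarrow> real"
  assumes bil: "bilinear a" and sym: "a u v = a v u" and pos: "u \<noteq> 0 \<Longrightarrow> a u u > 0"
begin

lemma radd: "a w (u + v) = a w u + a w v"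
  and lscale: "a (c *\<^sub>R u) w = c * a u w" and rscale: "a w (c *\<^sub>R u) = c * a w u"
  and ldiff: "a (u - v) w = a u w - a v w" and rdiff: "a w (u - v) = a w u - a w v"
  using bil by (simp_all add: bilinear_radd bilinear_lmul bilinear_rmul bilinear_lsub bilinear_rsub)

lemma lsum: "a (\<Sum>i\<in>I. f i) w = (\<Sum>i\<in>I. a (f i) w)" and rsum: "a w (\<Sum>i\<in>I. f i) = (\<Sum>i\<in>I. a w (f i))"
  using bil linear_sum[of "\<lambda>u. a u w" f I] linear_sum[of "a w" f I] unfolding bilinear_def by auto

text \<open>
  One step of the Gram-Schmidt process.
\<close>

lemma extend_orthonormal:
  assumes "finite S" "card S < CARD('m)" and E: "\<And>i j. i \<in> S \<Longrightarrow> j \<in> S \<Longrightarrow> a (E i) (E j) = (if i = j then 1 else 0)"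
  obtains w where "a w w = 1" "\<And>i. i \<in> S \<Longrightarrow> a (E i) w = 0"
proof -
  have "dim (E ` S) \<le> card (E ` S)" using assms(1) by (simp add: dim_le_card')
  also have "\<dots> \<le> card S" using assms(1) by (rule card_image_le)
  finally have "dim (E ` S) < DIM(real^'m)" using assms(2) by simp
  then have "span (E ` S) \<noteq> UNIV" by (metis dim_span dim_UNIV less_irrefl)
  then obtain v where v: "v \<notin> span (E ` S)" by blast
  define p where "p = (\<Sum>i\<in>S. a (E i) v *\<^sub>R E i)"
  have "p \<in> span (E ` S)" unfolding p_def by (intro span_sum span_scale span_base) auto
  then have ne: "v - p \<noteq> 0" using v by auto
  have orth: "a (E i) (v - p) = 0" if "i \<in> S" for i
  proof -
    have "a (E i) p = (\<Sum>j\<in>S. if j = i then a (E j) v else 0)"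
      unfolding p_def rsum rscale using E[OF that] by (intro sum.cong) auto
    then show ?thesis using assms(1) that by (simp add: rdiff)
  qed
  let ?n = "sqrt (a (v - p) (v - p))"
  have n: "?n > 0" using pos[OF ne] by simp
  show thesis
  proof
    show "a ((1 / ?n) *\<^sub>R (v - p)) ((1 / ?n) *\<^sub>R (v - p)) = 1"
      unfolding lscale rscale using pos[OF ne] by (simp flip: mult.assoc)
    show "a (E i) ((1 / ?n) *\<^sub>R (v - p)) = 0" if "i \<in> S" for i
      unfolding rscale orth[OF that] by simp
  qed
qed

lemma orthonormal_basis:
  "\<exists>E :: 'm \<Rightarrow> real^'m. \<forall>i j. a (E i) (E j) = (if i = j then 1 else 0)"
proof -
  have "\<exists>E. \<forall>i\<in>S. \<forall>j\<in>S. a (E i) (E j) = (if i = j then 1 else 0)" for S :: "'m set"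
    using finite[of S]
  proof (induction S rule: finite_induct)
    case empty
    then show ?case by simp
  next
    case (insert k S)
    then obtain E where E: "\<And>i j. i \<in> S \<Longrightarrow> j \<in> S \<Longrightarrow> a (E i) (E j) = (if i = j then 1 else 0)" by blast
    have "card S < CARD('m)" using insert(2) by (intro psubset_card_mono) auto
    then obtain w where w: "a w w = 1" "\<And>i. i \<in> S \<Longrightarrow> a (E i) w = 0"
      by (rule extend_orthonormal[OF insert(1), of E]) (auto simp: E)
    have w': "a w (E i) = 0" if "i \<in> S" for i using w(2)[OF that] sym by metis
    show ?case
      using E w w' insert(2) by (intro exI[of _ "E(k := w)"]) auto
  qed
  from this[of UNIV] show ?thesis by simp
qed

definition gram :: "real^'m^'m" where "gram = (\<chi> k l. a (axis k 1) (axis l 1))"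

lemma form_eq_gram: "a u v = (\<Sum>k\<in>UNIV. \<Sum>l\<in>UNIV. u $ k * v $ l * gram $ k $ l)"
proof -
  have "a u v = a (\<Sum>k\<in>UNIV. u $ k *\<^sub>R axis k 1) (\<Sum>l\<in>UNIV. v $ l *\<^sub>R axis l 1)"
    using basis_expansion[of u] basis_expansion[of v] by (simp add: scalar_mult_eq_scaleR)
  then show ?thesis 
    by (subst sum.swap) (simp add: lsum rsum lscale rscale gram_def mult_ac sum_distrib_left)
qed

text \<open>
  If \<open>P\<close> has the orthonormal vectors as columns and \<open>G\<close> is the Gram matrix, then orthonormality reads
  \<open>P\<^sup>T G P = I\<close>, and so \<open>G\<close> has the inverse \<open>P P\<^sup>T\<close>.
\<close>

lemma gram_inverse:
  fixes E :: "'m \<Rightarrow> real^'m"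
  assumes E: "\<And>i j. a (E i) (E j) = (if i = j then 1 else 0)"
  shows "matrix_inv gram $ k $ l = (\<Sum>i\<in>UNIV. E i $ k * E i $ l)" and "det gram \<noteq> 0"
proof -
  define P :: "real^'m^'m" where "P = (\<chi> k i. E i $ k)"
  have "(transpose P ** (gram ** P)) $ i $ j = (mat 1 :: real^'m^'m) $ i $ j" for i j
  proof -
    have "(transpose P ** (gram ** P)) $ i $ j = a (E i) (E j)"
      by (simp add: matrix_matrix_mult_def transpose_def P_def form_eq_gram sum_distrib_left mult_ac)
    then show ?thesis using E by (simp add: mat_def)
  qed
  then have 1: "transpose P ** (gram ** P) = mat 1" by (simp add: vec_eq_iff)
  then have "(gram ** P) ** transpose P = mat 1" using matrix_left_right_inverse by blast
  then have 2: "gram ** (P ** transpose P) = mat 1" by (simp add: matrix_mul_assoc)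
  then have 3: "(P ** transpose P) ** gram = mat 1" using matrix_left_right_inverse by blast
  have inv: "invertible gram" using 2 3 unfolding invertible_def by blast
  then show det: "det gram \<noteq> 0" by (simp add: invertible_det_nz)
  have "matrix_inv gram ** gram = mat 1" by (rule matrix_inv_works(2)[OF det])
  then have "matrix_inv gram = P ** transpose P"
    using 2 by (metis matrix_mul_assoc matrix_mul_lid matrix_mul_rid)
  then show "matrix_inv gram $ k $ l = (\<Sum>i\<in>UNIV. E i $ k * E i $ l)"
    by (simp add: matrix_matrix_mult_def transpose_def P_def)
qed

lemma det_gram: "det gram \<noteq> 0"
  using orthonormal_basis gram_inverse(2) by metis

text \<open>
  The trace is defined by the inverse Gram matrix in the coordinate basis; in this form its sign and its
  vanishing can be read off.
\<close>

lemma metric_trace_orthonormal: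
  fixes E :: "'m \<Rightarrow> real^'m" and b :: "real^'m \<Rightarrow> real^'m \<Rightarrow> 'b::real_vector"
  assumes E: "\<And>i j. a (E i) (E j) = (if i = j then 1 else 0)" 
    and b: "\<And>v. linear (\<lambda>u. b u v)" "\<And>u. linear (b u)"
  shows "metric_trace a b = (\<Sum>i\<in>UNIV. b (E i) (E i))"
proof -
  have "b u u = (\<Sum>k\<in>UNIV. \<Sum>l\<in>UNIV. (u $ k * u $ l) *\<^sub>R b (axis k 1) (axis l 1))" for u
  proof -
    have "b u u = b (\<Sum>k\<in>UNIV. u $ k *\<^sub>R axis k 1) (\<Sum>l\<in>UNIV. u $ l *\<^sub>R axis l 1)"
      using basis_expansion[of u] by (simp add: scalar_mult_eq_scaleR)
    also have "\<dots> = (\<Sum>k\<in>UNIV. u $ k *\<^sub>R b (axis k 1) (\<Sum>l\<in>UNIV. u $ l *\<^sub>R axis l 1))"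
      by (simp add: linear_sum[OF b(1)] linear_scale[OF b(1)])
    finally show ?thesis by (simp add: linear_sum[OF b(2)] linear_scale[OF b(2)] scaleR_sum_right)
  qed
  then have "(\<Sum>i\<in>UNIV. b (E i) (E i)) = 
      (\<Sum>i\<in>UNIV. \<Sum>k\<in>UNIV. \<Sum>l\<in>UNIV. (E i $ k * E i $ l) *\<^sub>R b (axis k 1) (axis l 1))" by simp
  also have "\<dots> = (\<Sum>k\<in>UNIV. \<Sum>i\<in>UNIV. \<Sum>l\<in>UNIV. (E i $ k * E i $ l) *\<^sub>R b (axis k 1) (axis l 1))"
    by (rule sum.swap)
  also have "\<dots> = (\<Sum>k\<in>UNIV. \<Sum>l\<in>UNIV. \<Sum>i\<in>UNIV. (E i $ k * E i $ l) *\<^sub>R b (axis k 1) (axis l 1))"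
    by (intro sum.cong refl sum.swap)
  also have "\<dots> = metric_trace a b"
    unfolding metric_trace_def gram_def[symmetric] gram_inverse(1)[OF E] scaleR_left.sum by simp
  finally show ?thesis by simp
qed

lemma orthonormal_expansion:
  fixes E :: "'m \<Rightarrow> real^'m"
  assumes E: "\<And>i j. a (E i) (E j) = (if i = j then 1 else 0)" 
  shows "u = (\<Sum>i\<in>UNIV. a u (E i) *\<^sub>R E i)"
proof -
  have inv: "matrix_inv gram ** gram = mat 1"
    by (rule matrix_inv_works(2)[OF det_gram])
  have E_sum: "(\<Sum>l\<in>UNIV. E i $ l * a (axis l 1) u) = a (E i) u" for i
  proof -
    have "a (E i) u = a (\<Sum>l\<in>UNIV. E i $ l *\<^sub>R axis l 1) u"
      using basis_expansion[of "E i"] by (simp add: scalar_mult_eq_scaleR)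
    then show ?thesis by (simp add: lsum lscale)
  qed
  have G: "(gram *v u) $ l = a (axis l 1) u" for l
  proof -
    have "a (axis l 1) u = a (axis l 1) (\<Sum>k\<in>UNIV. u $ k *\<^sub>R axis k 1)"
      using basis_expansion[of u] by (simp add: scalar_mult_eq_scaleR)
    then show ?thesis by (simp add: rsum rscale gram_def matrix_vector_mult_def mult_ac)
  qed
  have "u = matrix_inv gram *v (gram *v u)"
    by (simp add: matrix_vector_mul_assoc inv)
  also have "(matrix_inv gram *v (gram *v u)) $ k = (\<Sum>i\<in>UNIV. a u (E i) *\<^sub>R E i) $ k" for k
  proof -
    have "(matrix_inv gram *v (gram *v u)) $ k = (\<Sum>l\<in>UNIV. \<Sum>i\<in>UNIV. E i $ k * (E i $ l * a (axis l 1) u))"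
      unfolding matrix_vector_mult_def[of "matrix_inv gram"]
      by (simp add: gram_inverse(1)[OF E] G sum_distrib_right mult.assoc)
    also have "\<dots> = (\<Sum>i\<in>UNIV. E i $ k * a (E i) u)"
      by (subst sum.swap) (simp add: E_sum flip: sum_distrib_left)
    finally show ?thesis by (simp add: sym[of u] mult.commute)
  qed
  then have "matrix_inv gram *v (gram *v u) = (\<Sum>i\<in>UNIV. a u (E i) *\<^sub>R E i)"
    by (simp add: vec_eq_iff)
  finally show ?thesis .
qed

lemma trace_linear:
  assumes "linear L"
  shows "L (metric_trace b B) = metric_trace b (\<lambda>u v. L (B u v))"
  unfolding metric_trace_def by (simp add: linear_sum[OF assms] linear_scale[OF assms])

text \<open>
  Orthonormal expansion of a vector without a choice of basis.  Applied to the induced metric, it writes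
  the tangential part of a vector as a smooth function of the data.
\<close>

lemma trace_expansion: "metric_trace a (\<lambda>u v. a c u *\<^sub>R v) = c"
proof -
  obtain E :: "'m \<Rightarrow> real^'m" where E: "\<And>i j. a (E i) (E j) = (if i = j then 1 else 0)" using orthonormal_basis by blast
  have "metric_trace a (\<lambda>u v. a c u *\<^sub>R v) = (\<Sum>i\<in>UNIV. a c (E i) *\<^sub>R E i)"
    by (rule metric_trace_orthonormal[OF E]) (auto intro!: linearI simp: radd rscale algebra_simps)
  then show ?thesis using orthonormal_expansion[OF E, of c] by simp
qed

lemma representer:
  assumes "linear \<phi>"
  obtains c where "\<And>w. a c w = \<phi> w"
proof -
  obtain E :: "'m \<Rightarrow> real^'m" where E: "\<And>i j. a (E i) (E j) = (if i = j then 1 else 0)" using orthonormal_basis by blast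
  have "a (\<Sum>i\<in>UNIV. \<phi> (E i) *\<^sub>R E i) w = \<phi> w" for w
  proof -
    have "\<phi> w = \<phi> (\<Sum>i\<in>UNIV. a w (E i) *\<^sub>R E i)" using orthonormal_expansion[OF E, of w] by simp
    then show ?thesis by (simp add: linear_sum[OF assms] linear_scale[OF assms] lsum lscale sym[of w] mult.commute)
  qed
  then show thesis using that by blast
qed

lemma nondegenerate: "(\<And>w. a u w = a v w) \<Longrightarrow> u = v"
  using pos[of "u - v"] by (metis ldiff less_irrefl right_minus_eq)

lemma trace_self: "metric_trace a a = real CARD('m)"
proof -
  obtain E :: "'m \<Rightarrow> real^'m" where E: "\<And>i j. a (E i) (E j) = (if i = j then 1 else 0)" using orthonormal_basis by blast
  have "metric_trace a a = (\<Sum>i\<in>UNIV. a (E i) (E i))"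
    by (rule metric_trace_orthonormal[OF E]) (use bil in \<open>auto simp: bilinear_def\<close>)
  then show ?thesis by (simp add: E)
qed

lemma trace_transpose:
  assumes "\<And>v. linear (\<lambda>u. B u v)" "\<And>u. linear (B u)"
  shows "metric_trace a (\<lambda>u v. B v u) = metric_trace a B"
proof -
  obtain E :: "'m \<Rightarrow> real^'m" where E: "\<And>i j. a (E i) (E j) = (if i = j then 1 else 0)"
    using orthonormal_basis by blast
  show ?thesis using assms by (simp add: metric_trace_orthonormal[OF E])
qed

end

lemma metric_trace_add: "metric_trace b (\<lambda>u v. B u v + C u v) = metric_trace b B + metric_trace b C"
  by (simp add: metric_trace_def scaleR_add_right sum.distrib)

lemma metric_trace_scaleR: "metric_trace b (\<lambda>u v. r *\<^sub>R B u v) = r *\<^sub>R metric_trace b B"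
  by (simp add: metric_trace_def scaleR_sum_right mult.commute)

lemma metric_trace_minus: "metric_trace b (\<lambda>u v. - B u v) = - metric_trace b B"
  by (simp add: metric_trace_def sum_negf)

section \<open>Connection and curvature of the Fubini-Study metric\<close>

lemma smult_scaleR: "(r *\<^sub>R c) *s v = r *\<^sub>R (c *s v)" "c *s (r *\<^sub>R v) = r *\<^sub>R (c *s v)" for v :: "complex^'n"
  by (simp_all add: vec_eq_iff)

lemma bounded_bilinear_smult: "bounded_bilinear ((*s) :: complex \<Rightarrow> complex^'n \<Rightarrow> complex^'n)"
  unfolding bilinear_conv_bounded_bilinear[symmetric] bilinear_def
  by (auto intro!: linearI simp: vec_eq_iff algebra_simps)

lemma bounded_bilinear_hermitian: "bounded_bilinear (hermitian :: complex^'n \<Rightarrow> complex^'n \<Rightarrow> complex)"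
  unfolding bilinear_conv_bounded_bilinear[symmetric] bilinear_def hermitian_def
  by (auto intro!: linearI simp: algebra_simps sum.distrib scaleR_sum_right)

lemmas hermitian_add_left = bounded_bilinear.add_left[OF bounded_bilinear_hermitian]
  and hermitian_add_right = bounded_bilinear.add_right[OF bounded_bilinear_hermitian]
  and hermitian_minus_left = bounded_bilinear.minus_left[OF bounded_bilinear_hermitian]
  and hermitian_minus_right = bounded_bilinear.minus_right[OF bounded_bilinear_hermitian]
  and hermitian_diff_left = bounded_bilinear.diff_left[OF bounded_bilinear_hermitian]
  and hermitian_diff_right = bounded_bilinear.diff_right[OF bounded_bilinear_hermitian]
  and hermitian_zero_left = bounded_bilinear.zero_left[OF bounded_bilinear_hermitian]
  and hermitian_scaleR_left = bounded_bilinear.scaleR_left[OF bounded_bilinear_hermitian]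
  and hermitian_scaleR_right = bounded_bilinear.scaleR_right[OF bounded_bilinear_hermitian]

lemma hermitian_smult_left: "hermitian (c *s u) v = c * hermitian u v"
  and hermitian_smult_right: "hermitian u (c *s v) = cnj c * hermitian u v"
  by (simp_all add: hermitian_def sum_distrib_left mult_ac)

lemma cnj_hermitian: "cnj (hermitian u v) = hermitian v u"
  by (simp add: hermitian_def mult.commute)

lemma Re_hermitian: "Re (hermitian u v) = u \<bullet> v"
  by (simp add: hermitian_def inner_vec_def inner_complex_def)

lemma hermitian_self: "hermitian u u = complex_of_real ((norm u)\<^sup>2)"
proof -
  have "Im (hermitian u u) = 0" by (simp add: hermitian_def)
  then show ?thesis using Re_hermitian[of u u] by (simp add: complex_eq_iff power2_norm_eq_inner)
qed

lemma hermitian_Cauchy_Schwarz: "(cmod (hermitian u v))\<^sup>2 \<le> (norm u)\<^sup>2 * (norm v)\<^sup>2"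
proof (cases "hermitian u v = 0")
  case False
  let ?a = "hermitian u v"
  have "(cmod ?a)\<^sup>2 = Re (hermitian u (?a *s v))"
    by (simp add: hermitian_smult_right complex_norm_square[symmetric] mult.commute flip: of_real_power)
  also have "\<dots> \<le> norm u * norm (?a *s v)" unfolding Re_hermitian by (rule norm_cauchy_schwarz)
  also have "norm (?a *s v) = cmod ?a * norm v"
    by (simp add: norm_vec_def L2_set_def norm_mult power_mult_distrib real_sqrt_mult flip: sum_distrib_left)
  finally have "cmod ?a * cmod ?a \<le> (norm u * norm v) * cmod ?a" by (simp add: power2_eq_square mult_ac)
  then have "cmod ?a \<le> norm u * norm v" using False by simp
  then show ?thesis using power_mono[of "cmod ?a" "norm u * norm v" 2] by (simp add: power_mult_distrib)
qed simp

text \<open>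
  The factor \<open>1 / (1 + |w|\<^sup>2)\<close> as a complex number: metric, connection and curvature become polynomials in
  it and in values of the Hermitian form, and the identities between them become ring identities.
\<close>

definition fs_inv :: "complex^'n \<Rightarrow> complex" where
  "fs_inv w = inverse (1 + hermitian w w)"

text \<open>
  The Hermitian metric, complex linear in the first argument, whose real part is the Fubini-Study
  metric.  Its imaginary part is the pairing with \<open>J\<close>: \<open>Im k(u, v) = h(u, J v)\<close>.
\<close>

definition fs_hermitian :: "complex^'n \<Rightarrow> complex^'n \<Rightarrow> complex^'n \<Rightarrow> complex" where
  "fs_hermitian w u v = fs_inv w * hermitian u v - (fs_inv w)\<^sup>2 * (hermitian u w * hermitian w v)"

text \<open>
  The closed form of the Christoffel symbols in an affine chart.  It is complex bilinear in \<open>u\<close> and \<open>v\<close>, as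
  it must be for the Levi-Civita connection of a Kaehler metric in holomorphic coordinates.
\<close>

definition fs_christoffel :: "complex^'n \<Rightarrow> complex^'n \<Rightarrow> complex^'n \<Rightarrow> complex^'n" where
  "fs_christoffel w u v = - ((fs_inv w * hermitian u w) *s v + (fs_inv w * hermitian v w) *s u)"

lemma fs_inv_real: "fs_inv w = complex_of_real (inverse (1 + (norm w)\<^sup>2))"
  by (simp add: fs_inv_def hermitian_self)

lemma cnj_fs_inv: "cnj (fs_inv w) = fs_inv w" by (simp add: fs_inv_real)

text \<open>
  The reciprocal in \<open>fs_inv\<close> is a genuine one.
\<close>

lemma hermitian_self_ne: "1 + hermitian w w \<noteq> 0"
proof -
  have "Re (1 + hermitian w w) = 1 + (norm w)\<^sup>2" by (simp add: hermitian_self)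
  then show ?thesis by (metis add_pos_nonneg less_irrefl zero_complex.sel(1) zero_le_power2 zero_less_one)
qed

lemma fubini_study_eq: "fubini_study w u v = Re (fs_hermitian w u v)"
proof -
  have R: "Re (complex_of_real r * z) = r * Re z" for r z by simp
  show ?thesis
    unfolding fubini_study_def fs_hermitian_def fs_inv_real of_real_power[symmetric] minus_complex.sel R
    by (simp only: divide_inverse power_inverse mult.commute)
qed

lemma cnj_fs_hermitian: "cnj (fs_hermitian w u v) = fs_hermitian w v u"
  by (simp add: fs_hermitian_def cnj_hermitian cnj_fs_inv)

lemma fs_sym: "fubini_study w u v = fubini_study w v u"
  unfolding fubini_study_eq by (metis cnj_fs_hermitian complex_cnj(1) cnj.simps(1))

lemma fs_hermitian_simps:
  "fs_hermitian w (u + u') v = fs_hermitian w u v + fs_hermitian w u' v"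
  "fs_hermitian w u (v + v') = fs_hermitian w u v + fs_hermitian w u v'"
  "fs_hermitian w (c *s u) v = c * fs_hermitian w u v"
  "fs_hermitian w u (c *s v) = cnj c * fs_hermitian w u v"
  "fs_hermitian w (r *\<^sub>R u) v = of_real r * fs_hermitian w u v"
  "fs_hermitian w u (r *\<^sub>R v) = of_real r * fs_hermitian w u v"
  "fs_hermitian w (- u) v = - fs_hermitian w u v"
  "fs_hermitian w u (- v) = - fs_hermitian w u v"
  by (simp_all add: fs_hermitian_def hermitian_add_left hermitian_add_right hermitian_smult_left
      hermitian_smult_right hermitian_scaleR_left hermitian_scaleR_right hermitian_minus_left
      hermitian_minus_right scaleR_conv_of_real[where 'a=complex] algebra_simps)

lemma fs_bilinear: "bilinear (fubini_study w)"
  unfolding bilinear_def fubini_study_eq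
  by (auto intro!: linearI simp: fs_hermitian_simps)

lemmas fs_bounded_bilinear = fs_bilinear[unfolded bilinear_conv_bounded_bilinear]
lemmas fs_simps = bounded_bilinear.add_left[OF fs_bounded_bilinear] bounded_bilinear.add_right[OF fs_bounded_bilinear]
  bounded_bilinear.minus_left[OF fs_bounded_bilinear] bounded_bilinear.minus_right[OF fs_bounded_bilinear]
  bounded_bilinear.diff_left[OF fs_bounded_bilinear] bounded_bilinear.diff_right[OF fs_bounded_bilinear]
  bounded_bilinear.scaleR_left[OF fs_bounded_bilinear] bounded_bilinear.scaleR_right[OF fs_bounded_bilinear]
  bounded_bilinear.zero_left[OF fs_bounded_bilinear] bounded_bilinear.zero_right[OF fs_bounded_bilinear]

text \<open>
  By Cauchy-Schwarz, the subtracted term of the metric takes away at most \<open>|u|\<^sup>2 |w|\<^sup>2 / (1 + |w|\<^sup>2)\<^sup>2\<close>, which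
  leaves at least \<open>|u|\<^sup>2 / (1 + |w|\<^sup>2)\<^sup>2\<close>.
\<close>

lemma fs_pos: 
  assumes "u \<noteq> 0" shows "fubini_study w u u > 0"
proof -
  let ?s = "1 + (norm w)\<^sup>2"
  have s: "?s > 0" by (simp add: add_pos_nonneg)
  have "Re (hermitian u w * hermitian w u) = (cmod (hermitian u w))\<^sup>2"
    using complex_norm_square[of "hermitian u w"] cnj_hermitian[of u w] by (metis Re_complex_of_real)
  also have "\<dots> \<le> (norm u)\<^sup>2 * (norm w)\<^sup>2" by (rule hermitian_Cauchy_Schwarz)
  finally have "Re (hermitian u w * hermitian w u) / ?s\<^sup>2 \<le> (norm u)\<^sup>2 * (norm w)\<^sup>2 / ?s\<^sup>2"
    by (intro divide_right_mono) auto
  moreover have "(norm u)\<^sup>2 / ?s = ((norm u)\<^sup>2 + (norm u)\<^sup>2 * (norm w)\<^sup>2) / ?s\<^sup>2"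
  proof -
    have "(norm u)\<^sup>2 + (norm u)\<^sup>2 * (norm w)\<^sup>2 = (norm u)\<^sup>2 * ?s" by (simp add: distrib_left)
    then show ?thesis using s by (simp add: power2_eq_square[of ?s])
  qed
  moreover have "(norm u)\<^sup>2 / ?s\<^sup>2 > 0" using s assms by simp
  ultimately show ?thesis
    unfolding fubini_study_def hermitian_self by (simp add: add_divide_distrib)
qed

lemma fs_nonneg: "fubini_study w u u \<ge> 0"
  using fs_pos[of u w] by (cases "u = 0") (auto simp: fs_simps)

lemma fs_nondegenerate: "(\<And>w. fubini_study p u w = fubini_study p v w) \<Longrightarrow> u = v"
  using fs_pos[of "u - v" p] by (metis fs_simps(5) less_irrefl right_minus_eq)

lemma fs_christoffel_sym: "fs_christoffel w u v = fs_christoffel w v u"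
  by (simp add: fs_christoffel_def add.commute)

lemma has_derivative_hermitian:
  assumes "(V has_derivative V') (at x within S)" "(W has_derivative W') (at x within S)"
  shows "((\<lambda>x. hermitian (V x) (W x)) has_derivative (\<lambda>u. hermitian (V x) (W' u) + hermitian (V' u) (W x)))
     (at x within S)"
  by (rule bounded_bilinear.FDERIV[OF bounded_bilinear_hermitian assms])

lemma has_derivative_fs_inv:
  assumes "(f has_derivative f') (at x)"
  shows "((\<lambda>x. fs_inv (f x)) has_derivative 
     (\<lambda>u. - (fs_inv (f x))\<^sup>2 * (hermitian (f x) (f' u) + hermitian (f' u) (f x)))) (at x)"
proof -
  have "((\<lambda>x. 1 + hermitian (f x) (f x)) has_derivative
     (\<lambda>u. hermitian (f x) (f' u) + hermitian (f' u) (f x))) (at x)"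
    using has_derivative_add[OF has_derivative_const has_derivative_hermitian[OF assms assms]] by simp
  from Deriv.has_derivative_inverse[OF hermitian_self_ne this] show ?thesis
    by (simp add: fs_inv_def power2_eq_square mult_ac)
qed

text \<open>
  Compatibility of the connection with the metric, for vector fields along a map: with all derivatives
  written out, both sides are the same polynomial in \<open>fs_inv\<close> and in Hermitian products.
\<close>

lemma fs_hermitian_compatible:
  assumes f: "(f has_derivative f') (at x)" and V: "(V has_derivative V') (at x)"
    and W: "(W has_derivative W') (at x)"
  shows "((\<lambda>y. fs_hermitian (f y) (V y) (W y)) has_derivative (\<lambda>u.
     fs_hermitian (f x) (V' u + fs_christoffel (f x) (f' u) (V x)) (W x)
     + fs_hermitian (f x) (V x) (W' u + fs_christoffel (f x) (f' u) (W x)))) (at x)"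
proof -
  note I = has_derivative_fs_inv[OF f]
  note D = has_derivative_diff[OF has_derivative_mult[OF I has_derivative_hermitian[OF V W]]
      has_derivative_mult[OF has_derivative_mult[OF I I] 
        has_derivative_mult[OF has_derivative_hermitian[OF V f] has_derivative_hermitian[OF f W]]]]
  show ?thesis unfolding fs_hermitian_def power2_eq_square
    by (rule has_derivative_eq_rhs[OF D])
       (simp add: fun_eq_iff fs_christoffel_def hermitian_add_left hermitian_add_right hermitian_smult_left
         hermitian_smult_right hermitian_minus_left hermitian_minus_right hermitian_diff_left hermitian_diff_right cnj_hermitian cnj_fs_inv
         power2_eq_square algebra_simps)
qed

lemma fs_compatible:
  assumes "(f has_derivative f') (at x)" "(V has_derivative V') (at x)" "(W has_derivative W') (at x)"
  shows "((\<lambda>y. fubini_study (f y) (V y) (W y)) has_derivative (\<lambda>u.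
     fubini_study (f x) (V' u + fs_christoffel (f x) (f' u) (V x)) (W x)
     + fubini_study (f x) (V x) (W' u + fs_christoffel (f x) (f' u) (W x)))) (at x)"
  using has_derivative_Re[OF fs_hermitian_compatible[OF assms]] by (simp add: fubini_study_eq)

text \<open>
  A symmetric connection that is compatible with the metric satisfies the Koszul formula, and the
  metric is nondegenerate.
\<close>

lemma christoffel_fubini_study: "christoffel fubini_study p u v = fs_christoffel p u v"
proof -
  have D: "dderiv (\<lambda>y. fubini_study y v w) p u =
      fubini_study p (fs_christoffel p u v) w + fubini_study p v (fs_christoffel p u w)" for u v w
    using fs_compatible[OF has_derivative_ident has_derivative_const has_derivative_const]
    by (intro dderiv_eqI[THEN trans]) auto
  have K: "dderiv (\<lambda>y. fubini_study y v w) p u + dderiv (\<lambda>y. fubini_study y u w) p v 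
      - dderiv (\<lambda>y. fubini_study y u v) p w = 2 * fubini_study p (fs_christoffel p u v) w" for w
    unfolding D by (simp add: fs_christoffel_sym[of p v u] fs_christoffel_sym[of p w] fs_sym[of p v])
  show ?thesis unfolding christoffel_def K
    by (rule the_equality) (auto intro: fs_nondegenerate)
qed

text \<open>
  The curvature of constant holomorphic sectional curvature 4.  In terms of \<open>h\<close> and \<open>J\<close> this is the familiar
  \<open>h(Y,Z) X - h(X,Z) Y + h(JY,Z) JX - h(JX,Z) JY + 2 h(X,JY) JZ\<close>; the complex form is shorter, as the terms without
  and with \<open>J\<close> come from the real and imaginary parts of one coefficient.
\<close>

lemma riemann_curv_fubini_study:
  "riemann_curv fubini_study p X Y Z =
    (fs_hermitian p X Y - fs_hermitian p Y X) *s Z - fs_hermitian p Z X *s Y + fs_hermitian p Z Y *s X"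
proof -
  have D: "dderiv (\<lambda>q. fs_christoffel q Y Z) p X =
     - ((fs_inv p * hermitian Y X - (fs_inv p)\<^sup>2 * (hermitian p X + hermitian X p) * hermitian Y p) *s Z
      + (fs_inv p * hermitian Z X - (fs_inv p)\<^sup>2 * (hermitian p X + hermitian X p) * hermitian Z p) *s Y)"
    for X Y Z
  proof -
    note I = has_derivative_fs_inv[OF has_derivative_ident]
    note H = has_derivative_hermitian[OF has_derivative_const has_derivative_ident]
    note S = bounded_bilinear.FDERIV[OF bounded_bilinear_smult has_derivative_mult[OF I H] has_derivative_const]
    show ?thesis unfolding fs_christoffel_def
      by (rule dderiv_eqI[OF has_derivative_minus[OF has_derivative_add[OF S S]], THEN trans])
        (simp add: vec_eq_iff hermitian_zero_left algebra_simps)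
  qed
  show ?thesis
    unfolding riemann_curv_def levi_civita_def christoffel_fubini_study
    by (simp add: D) 
      (simp add: vec_eq_iff fs_christoffel_def fs_hermitian_def hermitian_add_left hermitian_smult_left
         hermitian_minus_left hermitian_diff_left power2_eq_square algebra_simps)
qed

lemma smooth_on_fs_inv:
  assumes "open W" "smooth_on f W"
  shows "smooth_on (\<lambda>x. fs_inv (f x)) W"
proof -
  have "smooth_on (\<lambda>x. inverse (Re (1 + hermitian (f x) (f x)))) W"
  proof (rule smooth_on_inverse[OF assms(1)])
    show "smooth_on (\<lambda>x. Re (1 + hermitian (f x) (f x))) W"
      by (intro smooth_on_linear[OF assms(1) bounded_linear_Re] smooth_on_add smooth_on_const
          smooth_on_bilinear[OF assms(1) bounded_bilinear_hermitian] assms)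
    show "Re (1 + hermitian (f x) (f x)) \<noteq> 0" for x
      using hermitian_self_ne[of "f x"] by (auto simp: complex_eq_iff hermitian_self)
  qed
  moreover have "Re (1 + hermitian (f x) (f x)) = 1 + (norm (f x))\<^sup>2" for x
    by (simp add: hermitian_self)
  ultimately show ?thesis
    using smooth_on_linear[OF assms(1) bounded_linear_of_real] by (simp only: fs_inv_real)
qed

section \<open>Immersions: induced connection and tension field\<close>

locale fs_immersion =
  fixes f :: "real^'m \<Rightarrow> complex^'n" and W :: "(real^'m) set"
  assumes open_W: "open W" and smooth_f: "smooth_on f W" 
    and inj_df: "x \<in> W \<Longrightarrow> inj (dderiv f x)"
begin

abbreviation g where "g \<equiv> induced_metric fubini_study f"
abbreviation df where "df x u \<equiv> dderiv f x u"
abbreviation nab where "nab V x u \<equiv> cov_along fubini_study f V x u"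
abbreviation hs where "hs x u v \<equiv> fubini_study (f x) u v"

lemma nab_eq: "nab V x u = dderiv V x u + fs_christoffel (f x) (df x u) (V x)"
  by (simp add: cov_along_def christoffel_fubini_study)

lemma linear_dderiv: "smooth_on V W \<Longrightarrow> x \<in> W \<Longrightarrow> linear (dderiv V x)"
  using smooth_on_has_derivative[OF _ open_W] has_derivative_linear by blast

lemmas linear_df = linear_dderiv[OF smooth_f]

lemma fs_christoffel_linear: "linear (\<lambda>u. fs_christoffel p u v)"
  by (rule linearI) (simp_all add: fs_christoffel_def vec_eq_iff hermitian_add_left hermitian_scaleR_left algebra_simps)

lemma linear_nab: 
  assumes "smooth_on V W" "x \<in> W" shows "linear (\<lambda>u. nab V x u)"
  unfolding nab_eq
  using linear_compose[OF linear_df[OF assms(2)] fs_christoffel_linear, of "f x" "V x"] linear_dderiv[OF assms]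
  by (auto intro!: linear_compose_add simp: o_def)

lemma inner_form_g: "x \<in> W \<Longrightarrow> inner_form (g x)"
proof
  assume x: "x \<in> W"
  show "bilinear (g x)" unfolding bilinear_def induced_metric_def
    by (auto intro!: linearI simp: fs_simps linear_add[OF linear_df[OF x]] linear_scale[OF linear_df[OF x]])
  show "g x u v = g x v u" for u v by (simp add: induced_metric_def fs_sym)
  show "g x u u > 0" if "u \<noteq> 0" for u
  proof -
    have "df x u \<noteq> 0" using injD[OF inj_df[OF x], of u 0] that linear_0[OF linear_df[OF x]] by auto
    then show ?thesis by (simp add: induced_metric_def fs_pos)
  qed
qed

lemma smooth_df: "smooth_on (\<lambda>x. df x v) W" by (rule smooth_on_dderiv[OF smooth_f])

lemma smooth_hs:
  assumes "smooth_on U W" "smooth_on V W" shows "smooth_on (\<lambda>x. hs x (U x) (V x)) W"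
  unfolding fubini_study_eq fs_hermitian_def power2_eq_square
  by (intro smooth_on_linear[OF open_W bounded_linear_Re] smooth_on_diff smooth_on_fs_inv open_W smooth_f assms
      smooth_on_bilinear[OF open_W bounded_bilinear_hermitian] smooth_on_bilinear[OF open_W bounded_bilinear_mult])

lemma smooth_nab:
  assumes "smooth_on V W" shows "smooth_on (\<lambda>x. nab V x u) W"
  unfolding nab_eq fs_christoffel_def
  by (intro smooth_on_add smooth_on_minus smooth_on_fs_inv smooth_on_dderiv open_W smooth_f assms
      smooth_on_bilinear[OF open_W bounded_bilinear_hermitian] smooth_on_bilinear[OF open_W bounded_bilinear_mult]
      smooth_on_bilinear[OF open_W bounded_bilinear_smult])

lemma compatible:
  assumes "smooth_on U W" "smooth_on V W" "x \<in> W"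
  shows "((\<lambda>y. hs y (U y) (V y)) has_derivative (\<lambda>u. hs x (nab U x u) (V x) + hs x (U x) (nab V x u))) (at x)"
  unfolding nab_eq
  using assms smooth_f open_W by (intro fs_compatible smooth_on_has_derivative)

text \<open>
  The product rule for a constant inner product is used three times: for \<open>h(\<tau>, df v) = 0\<close>, for the constant
  \<open>h(\<tau>, \<tau>)\<close>, and for \<open>h(\<nabla>\<tau>, \<tau>) = 0\<close>.
\<close>

lemma derivative_of_constant:
  assumes "smooth_on U W" "smooth_on V W" "x \<in> W" "\<And>y. y \<in> W \<Longrightarrow> hs y (U y) (V y) = r"
  shows "hs x (nab U x u) (V x) + hs x (U x) (nab V x u) = 0"
proof -
  have "((\<lambda>y. hs y (U y) (V y)) has_derivative (\<lambda>_. 0)) (at x)"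
    by (rule has_derivative_transform_within_open[OF has_derivative_const open_W assms(3)]) (simp add: assms(4))
  from has_derivative_unique[OF compatible[OF assms(1-3)] this] show ?thesis by meson
qed

lemma nab_cong:
  assumes "x \<in> W" "\<And>y. y \<in> W \<Longrightarrow> U y = V y" shows "nab U x u = nab V x u"
  using dderiv_transform[OF open_W assms] assms by (simp add: nab_eq)

lemma nab_scaleR:
  assumes "smooth_on V W" "x \<in> W" shows "nab (\<lambda>y. r *\<^sub>R V y) x u = r *\<^sub>R nab V x u"
proof -
  have "dderiv (\<lambda>y. r *\<^sub>R V y) x u = r *\<^sub>R dderiv V x u"
    by (rule dderiv_eqI[OF has_derivative_scaleR_right[OF smooth_on_has_derivative[OF assms(1) open_W assms(2)]]])
  moreover have "fs_christoffel p w (r *\<^sub>R v) = r *\<^sub>R fs_christoffel p w v" for p w v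
    using linear_scale[OF fs_christoffel_linear] fs_christoffel_sym by metis
  ultimately show ?thesis by (simp add: nab_eq scaleR_add_right)
qed

lemma nab_df_sym: "x \<in> W \<Longrightarrow> nab (\<lambda>y. df y v) x u = nab (\<lambda>y. df y u) x v"
  using second_derivative_symmetric[OF smooth_f open_W] by (simp add: nab_eq fs_christoffel_sym)

text \<open>
  The induced connection is the tangential part of the ambient one: add up the Koszul formula for the
  induced metric, using metric compatibility and the symmetry of \<open>\<nabla>df\<close>.
\<close>

lemma christoffel_induced:
  assumes x: "x \<in> W"
  shows "g x (christoffel g x u v) w = hs x (nab (\<lambda>y. df y v) x u) (df x w)"
proof -
  interpret inner_form "g x" by (rule inner_form_g[OF x])
  have D: "dderiv (\<lambda>y. g y v w) x u = hs x (nab (\<lambda>y. df y v) x u) (df x w) + hs x (df x v) (nab (\<lambda>y. df y w) x u)" for u v w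
    unfolding induced_metric_def by (rule dderiv_eqI[OF compatible[OF smooth_df smooth_df x]])
  have K: "dderiv (\<lambda>y. g y v w) x u + dderiv (\<lambda>y. g y u w) x v - dderiv (\<lambda>y. g y u v) x w
      = 2 * hs x (nab (\<lambda>y. df y v) x u) (df x w)" for w
    unfolding D by (simp add: nab_df_sym[OF x, of u v] nab_df_sym[OF x, of w] fs_sym[of "f x" "df x v"]
       fs_sym[of "f x" "df x u"])
  have "linear (\<lambda>w. hs x (nab (\<lambda>y. df y v) x u) (df x w))"
    by (rule linearI) (simp_all add: fs_simps linear_add[OF linear_df[OF x]] linear_scale[OF linear_df[OF x]])
  then obtain c where c: "\<And>w. g x c w = hs x (nab (\<lambda>y. df y v) x u) (df x w)" by (rule representer) blast
  have "christoffel g x u v = c" unfolding christoffel_def K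
    by (rule the_equality) (auto simp: c intro!: nondegenerate)
  then show ?thesis using c by simp
qed

lemma hessian_map_eq:
  "hessian_map g fubini_study f x u v = nab (\<lambda>y. df y v) x u - df x (christoffel g x u v)"
  by (simp add: hessian_map_def levi_civita_def)

lemma hessian_normal: "x \<in> W \<Longrightarrow> hs x (hessian_map g fubini_study f x u v) (df x w) = 0"
  using christoffel_induced[of x u v w] by (simp add: hessian_map_eq fs_simps induced_metric_def)

lemma tangential_part_eqI:
  assumes x: "x \<in> W" and orth: "\<And>w. hs x (V - df x a) (df x w) = 0"
  shows "tangential_part fubini_study f x V = df x a"
  unfolding tangential_part_def tangent_space_def
proof (rule the_equality)
  show "df x a \<in> range (df x) \<and> (\<forall>s\<in>range (df x). hs x (V - df x a) s = 0)" using orth by auto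
  fix t assume t: "t \<in> range (df x) \<and> (\<forall>s\<in>range (df x). hs x (V - t) s = 0)"
  then obtain b where b: "t = df x b" by auto
  have "hs x (df x (b - a)) (df x (b - a)) = hs x (V - df x a) (df x (b - a)) - hs x (V - t) (df x (b - a))"
    by (simp add: b linear_diff[OF linear_df[OF x]] fs_simps)
  also have "\<dots> = 0" using orth t by auto
  finally have "df x (b - a) = 0" using fs_pos less_irrefl by metis
  then show "t = df x a" using b linear_diff[OF linear_df[OF x]] by simp
qed

lemma second_fund_form_eq: "x \<in> W \<Longrightarrow> second_fund_form fubini_study f x = hessian_map g fubini_study f x"
proof (intro ext)
  fix u v assume x: "x \<in> W"
  have "tangential_part fubini_study f x (nab (\<lambda>y. df y v) x u) = df x (christoffel g x u v)"
    using hessian_normal[OF x] by (intro tangential_part_eqI[OF x]) (simp add: hessian_map_eq)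
  then show "second_fund_form fubini_study f x u v = hessian_map g fubini_study f x u v"
    by (simp add: second_fund_form_def normal_part_def hessian_map_eq)
qed

abbreviation tau where "tau \<equiv> tension g fubini_study f"

lemma mean_curv_eq: "x \<in> W \<Longrightarrow> mean_curv fubini_study f x = (1 / real CARD('m)) *\<^sub>R tau x"
  by (simp add: mean_curv_def tension_def second_fund_form_eq)

lemma smooth_metric_trace:
  assumes "\<And>i j. smooth_on (\<lambda>x. B x (axis i 1) (axis j 1)) W"
  shows "smooth_on (\<lambda>x. metric_trace (g x) (B x)) W"
  unfolding metric_trace_def
proof (intro smooth_on_sum open_W smooth_on_bilinear[OF open_W bounded_bilinear_scaleR] assms)
  fix i j :: 'm
  show "smooth_on (\<lambda>x. matrix_inv (\<chi> k l. g x (axis k 1) (axis l 1)) $ i $ j) W"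
  proof (rule smooth_on_matrix_inv[OF open_W])
    show "smooth_on (\<lambda>x. (\<chi> k l. g x (axis k 1) (axis l 1)) $ i $ j) W" for i j
      by (simp add: induced_metric_def smooth_hs smooth_df)
    show "det (\<chi> k l. g x (axis k 1) (axis l 1)) \<noteq> 0" if "x \<in> W" for x
      using inner_form.det_gram[OF inner_form_g[OF that]] 
      unfolding inner_form.gram_def[OF inner_form_g[OF that]] .
  qed
qed

text \<open>
  The tangential part of \<open>\<nabla>df\<close> in terms of quantities already known to be smooth; the definition of
  the Christoffel symbols by a definite description gives no access to their smoothness.
\<close>

lemma df_christoffel:
  assumes x: "x \<in> W"
  shows "df x (christoffel g x u v) =
    metric_trace (g x) (\<lambda>a b. hs x (nab (\<lambda>y. df y v) x u) (df x a) *\<^sub>R df x b)"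
proof -
  interpret inner_form "g x" by (rule inner_form_g[OF x])
  have "df x (christoffel g x u v) = df x (metric_trace (g x) (\<lambda>a b. g x (christoffel g x u v) a *\<^sub>R b))"
    by (simp add: trace_expansion)
  also have "\<dots> = metric_trace (g x) (\<lambda>a b. g x (christoffel g x u v) a *\<^sub>R df x b)"
    by (simp add: trace_linear[OF linear_df[OF x]] linear_scale[OF linear_df[OF x]])
  finally show ?thesis by (simp add: christoffel_induced[OF x])
qed

lemma smooth_tau: "smooth_on tau W"
proof -
  have "smooth_on (\<lambda>x. hessian_map g fubini_study f x u v) W" for u v
  proof -
    have "smooth_on (\<lambda>x. nab (\<lambda>y. df y v) x u - 
       metric_trace (g x) (\<lambda>a b. hs x (nab (\<lambda>y. df y v) x u) (df x a) *\<^sub>R df x b)) W"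
      by (intro smooth_on_diff smooth_metric_trace smooth_on_bilinear[OF open_W bounded_bilinear_scaleR]
         smooth_hs smooth_nab smooth_df open_W)
    then show ?thesis
      by (rule smooth_on_cong[THEN iffD1, OF open_W, rotated]) (simp add: hessian_map_eq df_christoffel)
  qed
  then show ?thesis unfolding tension_def by (intro smooth_metric_trace)
qed

lemma linear_hs_left: "linear (\<lambda>v. hs x v w)" and linear_hs_right: "linear (hs x w)"
  using fs_bilinear[of "f x"] by (auto simp: bilinear_def)

lemma tau_normal: "x \<in> W \<Longrightarrow> hs x (tau x) (df x w) = 0"
proof -
  assume x: "x \<in> W"
  have "hs x (tau x) (df x w) = metric_trace (g x) (\<lambda>u v. hs x (hessian_map g fubini_study f x u v) (df x w))"
    unfolding tension_def by (rule inner_form.trace_linear[OF inner_form_g[OF x] linear_hs_left])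
  then show ?thesis by (simp add: hessian_normal[OF x] metric_trace_def)
qed

text \<open>
  The Weingarten equation, from differentiating \<open>h(\<tau>, df v) = 0\<close>.
\<close>

lemma weingarten_eq:
  assumes x: "x \<in> W"
  shows "hs x (nab tau x u) (df x v) = - hs x (tau x) (hessian_map g fubini_study f x u v)"
  using derivative_of_constant[OF smooth_tau smooth_df x tau_normal, of u v]
    tau_normal[OF x, of "christoffel g x u v"]
  by (simp add: hessian_map_eq fs_simps)

lemma trace_weingarten:
  assumes x: "x \<in> W"
  shows "metric_trace (g x) (\<lambda>u v. hs x (nab tau x u) (df x v)) = - hs x (tau x) (tau x)"
proof -
  have "hs x (tau x) (tau x) = metric_trace (g x) (\<lambda>u v. hs x (tau x) (hessian_map g fubini_study f x u v))"
    by (subst (2) tension_def) (rule inner_form.trace_linear[OF inner_form_g[OF x] linear_hs_right])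
  then show ?thesis
    by (simp add: weingarten_eq[OF x] metric_trace_minus)
qed


section \<open>The biharmonic equation along an immersion\<close>

text \<open>
  Over an orthonormal basis \<open>e\<^sub>i\<close> of the tangent space, normality of \<open>\<tau>\<close> leaves \<open>k(e\<^sub>i, \<tau>) = \<i> h(e\<^sub>i, J\<tau>)\<close>.
  Each basis vector thus contributes \<open>3 h(e\<^sub>i, J\<tau>) J e\<^sub>i - \<tau>\<close>.  The first terms add up to \<open>3 J J\<tau> = - 3 \<tau>\<close>
  because \<open>J\<tau>\<close> is tangent, the second ones to \<open>- m \<tau>\<close>.
\<close>

lemma curvature_trace:
  assumes x: "x \<in> W" and J: "\<i> *s tau x \<in> range (df x)"
  shows "metric_trace (g x) (\<lambda>u v. riemann_curv fubini_study (f x) (df x u) (tau x) (df x v))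
     = - (real CARD('m) + 3) *\<^sub>R tau x"
proof -
  interpret inner_form "g x" by (rule inner_form_g[OF x])
  obtain E :: "'m \<Rightarrow> real^'m" where E: "\<And>i j. g x (E i) (E j) = (if i = j then 1 else 0)" using orthonormal_basis by blast
  obtain b where b: "\<i> *s tau x = df x b" using J by auto
  note lin = linear_add[OF linear_df[OF x]] linear_scale[OF linear_df[OF x]]
  let ?R = "\<lambda>u v. riemann_curv fubini_study (f x) (df x u) (tau x) (df x v)"
  have summand: "?R (E i) (E i) = (3 * \<i>) *s (g x b (E i) *\<^sub>R df x (E i)) - tau x" for i
  proof -
    let ?e = "df x (E i)" and ?k = "fs_hermitian (f x)"
    have "Re (?k (tau x) ?e) = 0" using tau_normal[OF x] by (simp add: fubini_study_eq)
    moreover have "Re (?k (\<i> *s tau x) ?e) = g x b (E i)"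
      by (simp add: b induced_metric_def fubini_study_eq)
    ultimately have k1: "?k (tau x) ?e = - \<i> * g x b (E i)"
      by (simp add: fs_hermitian_simps complex_eq_iff)
    then have k2: "?k ?e (tau x) = \<i> * g x b (E i)"
      using cnj_fs_hermitian[of "f x" "tau x" ?e] by simp
    have "Re (?k ?e ?e) = 1" using E[of i i] by (simp add: induced_metric_def fubini_study_eq)
    moreover have "Im (?k ?e ?e) = 0" using cnj_fs_hermitian[of "f x" ?e ?e] by (simp add: complex_eq_iff)
    ultimately have k3: "?k ?e ?e = 1" by (simp add: complex_eq_iff)
    show ?thesis unfolding riemann_curv_fubini_study k1 k2 k3
      by (simp add: vec_eq_iff algebra_simps scaleR_conv_of_real[where 'a=complex])
  qed
  have "metric_trace (g x) ?R = (\<Sum>i\<in>UNIV. ?R (E i) (E i))"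
    by (rule metric_trace_orthonormal[OF E]; rule linearI; 
        simp add: riemann_curv_fubini_study lin fs_hermitian_simps;
        simp add: vec_eq_iff algebra_simps scaleR_conv_of_real[where 'a=complex])
  also have "\<dots> = (3 * \<i>) *s (\<Sum>i\<in>UNIV. g x b (E i) *\<^sub>R df x (E i)) - real CARD('m) *\<^sub>R tau x"
    by (simp add: summand sum_subtractf bounded_bilinear.sum_right[OF bounded_bilinear_smult] sum_constant_scaleR del: sum_constant)
  also have "(\<Sum>i\<in>UNIV. g x b (E i) *\<^sub>R df x (E i)) = df x b"
    using arg_cong[OF orthonormal_expansion[OF E, of b], of "df x"]
    by (simp add: linear_sum[OF linear_df[OF x]] lin)
  also have "\<dots> = \<i> *s tau x" using b by simp
  also have "(3 * \<i>) *s (\<i> *s tau x) = - (3 *\<^sub>R tau x)"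
    by (simp add: vec_eq_iff scaleR_conv_of_real[where 'a=complex])
  also have "- (3 *\<^sub>R tau x) - real CARD('m) *\<^sub>R tau x = - (real CARD('m) + 3) *\<^sub>R tau x"
    by (simp add: algebra_simps)
  finally show ?thesis .
qed

lemma bitension_eq:
  assumes x: "x \<in> W" and J: "\<i> *s tau x \<in> range (df x)"
  shows "bitension g fubini_study f x =
    (real CARD('m) + 3) *\<^sub>R tau x - rough_laplacian g fubini_study f tau x"
  unfolding bitension_def curvature_trace[OF assms] scaleR_minus_left by simp

text \<open>
  The Bochner argument \<open>0 = (1/2) \<Delta> h(\<tau>, \<tau>) = h(\<Delta>\<tau>, \<tau>) - |\<nabla>\<tau>|\<^sup>2\<close>, before taking the trace.  The term with
  the derivative in the direction of a Christoffel vector drops out because every \<open>\<nabla>\<^sub>w \<tau>\<close> is orthogonal to \<open>\<tau>\<close>.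
\<close>

lemma laplacian_inner_tau:
  assumes x: "x \<in> W" and const: "\<And>y. y \<in> W \<Longrightarrow> hs y (tau y) (tau y) = T"
  shows "hs x (rough_laplacian g fubini_study f tau x) (tau x) =
     metric_trace (g x) (\<lambda>u v. hs x (nab tau x u) (nab tau x v))"
proof -
  have perp: "hs y (nab tau y v) (tau y) = 0" if "y \<in> W" for y v
    using derivative_of_constant[OF smooth_tau smooth_tau that const, of v] fs_sym[of "f y" "tau y" "nab tau y v"]
    by linarith
  have "hs x (nab (\<lambda>y. nab tau y v) x u) (tau x) + hs x (nab tau x v) (nab tau x u) = 0" for u v
    by (rule derivative_of_constant[OF smooth_nab[OF smooth_tau] smooth_tau x perp])
  then have 2: "hs x (nab (\<lambda>y. nab tau y v) x u - nab tau x w) (tau x) = - hs x (nab tau x u) (nab tau x v)" for u v w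
    using perp[OF x, of w] fs_sym[of "f x" "nab tau x u" "nab tau x v"] unfolding fs_simps
    by (metis add.commute add_eq_0_iff diff_zero)
  show ?thesis
    unfolding rough_laplacian_def fs_simps(3) inner_form.trace_linear[OF inner_form_g[OF x] linear_hs_left] 2
    by (simp add: metric_trace_minus)
qed

text \<open>
  Expand the square: \<open>|\<nabla>\<tau>|\<^sup>2 = (m + 3) T\<close>, each mixed term has trace \<open>- T\<close>, and the induced metric has trace
  \<open>m\<close>.  The coefficient \<open>T/m\<close> of \<open>df\<close> is the one that minimises the result.
\<close>

lemma trace_umbilicity_defect:
  assumes x: "x \<in> W" and J: "\<i> *s tau x \<in> range (df x)" and bi: "bitension g fubini_study f x = 0"
    and const: "\<And>y. y \<in> W \<Longrightarrow> hs y (tau y) (tau y) = T"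
    and L: "\<And>u. L u = nab tau x u + (T / real CARD('m)) *\<^sub>R df x u"
  shows "metric_trace (g x) (\<lambda>u v. hs x (L u) (L v)) = (real CARD('m) + 3) * T - T\<^sup>2 / real CARD('m)"
proof -
  let ?m = "real CARD('m)" and ?k = "T / real CARD('m)"
  interpret inner_form "g x" by (rule inner_form_g[OF x])
  have "rough_laplacian g fubini_study f tau x = (?m + 3) *\<^sub>R tau x"
    using bi bitension_eq[OF x J] by simp
  then have N: "metric_trace (g x) (\<lambda>u v. hs x (nab tau x u) (nab tau x v)) = (?m + 3) * T"
    using laplacian_inner_tau[OF x const] const[OF x] by (simp add: fs_simps)
  note lin = linear_add[OF linear_df[OF x]] linear_scale[OF linear_df[OF x]]
     linear_add[OF linear_nab[OF smooth_tau x]] linear_scale[OF linear_nab[OF smooth_tau x]]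
  have A: "metric_trace (g x) (\<lambda>u v. hs x (nab tau x u) (df x v)) = - T"
    using trace_weingarten[OF x] const[OF x] by simp
  have A': "metric_trace (g x) (\<lambda>u v. hs x (nab tau x v) (df x u)) = - T"
    unfolding A[symmetric] by (rule trace_transpose; rule linearI; simp add: fs_simps lin)
  have "(\<lambda>u v. hs x (L u) (L v)) = (\<lambda>u v. hs x (nab tau x u) (nab tau x v)
     + (?k *\<^sub>R hs x (nab tau x u) (df x v) + (?k *\<^sub>R hs x (nab tau x v) (df x u) + (?k * ?k) *\<^sub>R g x u v)))"
    by (intro ext) (simp add: L fs_simps induced_metric_def fs_sym[of "f x" "df x u" "nab tau x v" for u v] algebra_simps)
  then show ?thesis
    by (simp only: metric_trace_add metric_trace_scaleR N A A' trace_self) (simp add: power2_eq_square)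
qed

lemma trace_square_nonneg:
  assumes x: "x \<in> W" and "linear L"
  shows "metric_trace (g x) (\<lambda>u v. hs x (L u) (L v)) \<ge> 0"
    and "metric_trace (g x) (\<lambda>u v. hs x (L u) (L v)) = 0 \<Longrightarrow> L u = 0"
proof -
  interpret inner_form "g x" by (rule inner_form_g[OF x])
  obtain E :: "'m \<Rightarrow> real^'m" where E: "\<And>i j. g x (E i) (E j) = (if i = j then 1 else 0)" using orthonormal_basis by blast
  have tr: "metric_trace (g x) (\<lambda>u v. hs x (L u) (L v)) = (\<Sum>i\<in>UNIV. hs x (L (E i)) (L (E i)))"
    by (rule metric_trace_orthonormal[OF E]; rule linearI; 
        simp add: linear_add[OF assms(2)] linear_scale[OF assms(2)] fs_simps)
  show "metric_trace (g x) (\<lambda>u v. hs x (L u) (L v)) \<ge> 0"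
    unfolding tr by (intro sum_nonneg fs_nonneg)
  assume "metric_trace (g x) (\<lambda>u v. hs x (L u) (L v)) = 0"
  then have "hs x (L (E i)) (L (E i)) = 0" for i
    unfolding tr by (subst (asm) sum_nonneg_eq_0_iff) (auto simp: fs_nonneg)
  then have "L (E i) = 0" for i using fs_pos less_irrefl by metis
  moreover have "L u = (\<Sum>i\<in>UNIV. g x u (E i) *\<^sub>R L (E i))"
    using arg_cong[OF orthonormal_expansion[OF E, of u], of L]
    by (simp add: linear_sum[OF assms(2)] linear_scale[OF assms(2)])
  ultimately show "L u = 0" by simp
qed

lemma linear_umbilicity_defect: 
  "x \<in> W \<Longrightarrow> linear (\<lambda>u. nab tau x u + k *\<^sub>R df x u)"
  by (intro linear_compose_add linear_nab smooth_tau linear_compose_scale_right linear_df)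

text \<open>
  The first conclusion is \<open>|L|\<^sup>2 \<ge> 0\<close> for \<open>L = \<nabla>\<tau> + (T/m) df\<close>, the second is \<open>L = 0\<close> when \<open>|L|\<^sup>2 = 0\<close>.
\<close>

theorem biharmonic_norm_bound:
  assumes x: "x \<in> W" and J: "\<i> *s tau x \<in> range (df x)" and bi: "bitension g fubini_study f x = 0"
    and const: "\<And>y. y \<in> W \<Longrightarrow> hs y (tau y) (tau y) = T" and T: "T > 0"
  shows "T \<le> real CARD('m) * (real CARD('m) + 3)"
    and "T = real CARD('m) * (real CARD('m) + 3) \<Longrightarrow> nab tau x u = - (real CARD('m) + 3) *\<^sub>R df x u"
proof -
  let ?m = "real CARD('m)"
  have m: "?m > 0" by simp
  let ?L = "\<lambda>u. nab tau x u + (T / ?m) *\<^sub>R df x u"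
  have tr: "metric_trace (g x) (\<lambda>u v. hs x (?L u) (?L v)) = (?m + 3) * T - T\<^sup>2 / ?m"
    by (rule trace_umbilicity_defect[OF x J bi const refl])
  note nn = trace_square_nonneg[OF x linear_umbilicity_defect[OF x]]
  have "T * (T / ?m) \<le> T * (?m + 3)"
    using nn(1)[of "T / ?m"] unfolding tr by (simp add: power2_eq_square mult.commute)
  then have "T / ?m \<le> ?m + 3" using mult_le_cancel_left_pos[OF T] by blast
  then show "T \<le> ?m * (?m + 3)" using m by (simp add: pos_divide_le_eq mult.commute)
  assume eq: "T = ?m * (?m + 3)"
  then have q: "T / ?m = ?m + 3" using m by simp
  have "(?m + 3) * T - T\<^sup>2 / ?m = 0" using q by (simp add: power2_eq_square flip: times_divide_eq_right)
  then have "?L u = 0" using tr nn(2)[of "T / ?m" u] by simp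
  then show "nab tau x u = - (?m + 3) *\<^sub>R df x u" unfolding q scaleR_minus_left by (simp only: eq_neg_iff_add_eq_0)
qed

text \<open>
  One more derivative turns \<open>df\<close> into \<open>\<nabla>df\<close>, whose trace is \<open>\<tau>\<close>; so \<open>\<tau>\<close> is an eigenfield of the rough Laplacian
  for the eigenvalue \<open>m + 3\<close>.
\<close>

theorem biharmonicI:
  assumes x: "x \<in> W" and J: "\<i> *s tau x \<in> range (df x)"
    and par: "\<And>y u. y \<in> W \<Longrightarrow> nab tau y u = - (real CARD('m) + 3) *\<^sub>R df y u"
  shows "bitension g fubini_study f x = 0"
proof -
  let ?c = "- (real CARD('m) + 3)"
  have "nab (\<lambda>y. nab tau y v) x u - nab tau x (levi_civita g (\<lambda>_. v) x u) 
     = ?c *\<^sub>R hessian_map g fubini_study f x u v" for u v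
  proof -
    have "nab (\<lambda>y. nab tau y v) x u = nab (\<lambda>y. ?c *\<^sub>R df y v) x u"
      by (rule nab_cong[OF x]) (rule par)
    also have "\<dots> = ?c *\<^sub>R nab (\<lambda>y. df y v) x u" by (rule nab_scaleR[OF smooth_df x])
    finally show ?thesis by (simp only: par[OF x] hessian_map_def scaleR_diff_right)
  qed
  then have "rough_laplacian g fubini_study f tau x = (real CARD('m) + 3) *\<^sub>R tau x"
    unfolding rough_laplacian_def by (simp only: metric_trace_minus metric_trace_scaleR tension_def scaleR_minus_left minus_minus)
  then show ?thesis unfolding bitension_eq[OF x J] by simp
qed

lemma nab_mean_curv: 
  "x \<in> W \<Longrightarrow> nab (mean_curv fubini_study f) x u = (1 / real CARD('m)) *\<^sub>R nab tau x u"
  using nab_cong[of x "mean_curv fubini_study f" "\<lambda>y. (1 / real CARD('m)) *\<^sub>R tau y"] mean_curv_eq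
    nab_scaleR[OF smooth_tau] by simp

text \<open>
  The two conditions of (b) are the tangential and the normal part of the one equation
  \<open>\<nabla>H = - k df\<close>.
\<close>

lemma umbilical_parallel_iff:
  assumes x: "x \<in> W"
  shows "(weingarten fubini_study f (mean_curv fubini_study f) x u = k *\<^sub>R df x u
      \<and> normal_connection fubini_study f (mean_curv fubini_study f) x u = 0)
    \<longleftrightarrow> nab (mean_curv fubini_study f) x u = - k *\<^sub>R df x u" (is "?l \<longleftrightarrow> ?r")
proof
  assume ?l
  then show ?r by (auto simp: weingarten_def normal_connection_def normal_part_def neg_equal_iff_equal minus_equation_iff)
next
  assume r: ?r
  have "- k *\<^sub>R df x u = df x (- k *\<^sub>R u)" using linear_scale[OF linear_df[OF x]] by metis
  then have "tangential_part fubini_study f x (nab (mean_curv fubini_study f) x u) = - k *\<^sub>R df x u"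
    using r tangential_part_eqI[OF x, of "nab (mean_curv fubini_study f) x u" "- k *\<^sub>R u"] by (simp add: fs_simps)
  then show ?l using r by (simp add: weingarten_def normal_connection_def normal_part_def)
qed

end


section \<open>Submanifolds of complex projective space\<close>

lemma complex_line_smult: "c \<noteq> 0 \<Longrightarrow> complex_line (c *s z) = complex_line z"
proof -
  assume c: "c \<noteq> 0"
  have "d *s z = (d / c) *s (c *s z)" for d using c by (simp add: vec_eq_iff)
  then have "d *s z \<in> complex_line (c *s z)" for d unfolding complex_line_def by blast
  moreover have "d *s (c *s z) \<in> complex_line z" for d
    unfolding complex_line_def vector_smult_assoc by blast
  ultimately show ?thesis unfolding complex_line_def by blast
qed

text \<open>
  Dividing by a nonzero homogeneous coordinate moves a point into the affine chart of that coordinate.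
\<close>

lemma CP_affine_cover:
  assumes "p \<in> CP" obtains i where "p \<in> range (affine_param i)"
proof -
  obtain z where z: "p = complex_line z" "z \<noteq> 0" using assms unfolding CP_def by auto
  then obtain i where i: "z $ i \<noteq> 0" by (auto simp: vec_eq_iff)
  \<comment> \<open>w lists the other homogeneous coordinates over z $ i; if i = Some k, the one at None takes slot k\<close>
  define w :: "complex^'a" where "w = (\<chi> k. (if Some k = i then z $ None else z $ Some k) / z $ i)"
  have "(\<chi> j. if j = i then 1 else if j = None then w $ the i else w $ the j) = (1 / z $ i) *s z"
  proof (unfold vec_eq_iff, intro allI)
    fix j show "(\<chi> j. if j = i then 1 else if j = None then w $ the i else w $ the j) $ j = ((1 / z $ i) *s z) $ j"
      using i by (cases j; cases i) (auto simp: w_def)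
  qed
  then have "affine_param i w = p"
    using complex_line_smult[of "1 / z $ i" z] i z(1) by (simp add: affine_param_def)
  then show thesis using that by blast
qed

text \<open>
  The conditions on a submanifold quantify over all coordinate expressions of the inclusion.  There has to
  be at least one of them, at some point, for a nonzero mean curvature to exclude harmonicity and for the
  bound on \<open>c\<close> to be derived.
\<close>

lemma inclusion_rep_exists:
  assumes "cp_submanifold M A"
  obtains W f x where "(W, f) \<in> inclusion_reps A" "x \<in> W"
proof -
  from assms obtain p where p: "p \<in> M" unfolding cp_submanifold_def ex_in_conv[symmetric] by (elim conjE exE)
  have "M \<subseteq> CP" using assms unfolding cp_submanifold_def by (elim conjE)
  have M: "M = (\<Union>(U, \<psi>)\<in>A. \<psi> ` U)" using assms unfolding cp_submanifold_def by (elim conjE)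
  from p obtain U \<psi> x where x: "(U, \<psi>) \<in> A" "x \<in> U" "p = \<psi> x" unfolding M by blast
  with p \<open>M \<subseteq> CP\<close> have "\<psi> x \<in> CP" by blast
  obtain i where "\<psi> x \<in> range (affine_param i)" by (rule CP_affine_cover[OF \<open>\<psi> x \<in> CP\<close>])
  then show thesis
    using x that[of "{x \<in> U. \<psi> x \<in> range (affine_param i)}" "\<lambda>x. affine_coord i (\<psi> x)" x]
    unfolding inclusion_reps_def by blast
qed

lemma inclusion_rep_immersion:
  assumes "cp_submanifold M A" "(W, f) \<in> inclusion_reps A"
  shows "fs_immersion f W"
proof -
  have "\<forall>(W, f)\<in>inclusion_reps A. open W \<and> smooth_on f W \<and> (\<forall>x\<in>W. inj (dderiv f x))"
    using assms(1) unfolding cp_submanifold_def by (elim conjE)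
  from bspec[OF this assms(2)] show ?thesis by (simp add: fs_immersion_def)
qed

locale cmc_fs_immersion = fs_immersion f W for f :: "real^'m \<Rightarrow> complex^'n" and W +
  fixes c :: real
  assumes JH: "x \<in> W \<Longrightarrow> complex_structure (mean_curv fubini_study f x) \<in> tangent_space f x"
    and cmc: "x \<in> W \<Longrightarrow> fs_norm (f x) (mean_curv fubini_study f x) = c"
begin

lemma tau_eq: "x \<in> W \<Longrightarrow> tau x = real CARD('m) *\<^sub>R mean_curv fubini_study f x"
  by (simp add: mean_curv_eq)

lemma J_tau: "x \<in> W \<Longrightarrow> \<i> *s tau x \<in> range (df x)"
proof -
  assume x: "x \<in> W"
  obtain a where "\<i> *s mean_curv fubini_study f x = df x a"
    using JH[OF x] unfolding complex_structure_def tangent_space_def by auto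
  then have "\<i> *s tau x = df x (real CARD('m) *\<^sub>R a)"
    unfolding linear_scale[OF linear_df[OF x]] tau_eq[OF x] smult_scaleR(2) by simp
  then show ?thesis by blast
qed

lemma norm_tau: "x \<in> W \<Longrightarrow> hs x (tau x) (tau x) = (real CARD('m))\<^sup>2 * c\<^sup>2"
  using cmc[of x] fs_nonneg[of "f x"] unfolding tau_eq fs_norm_def 
  by (auto simp: fs_simps power2_eq_square)

lemma mean_curvature_bound:
  assumes x: "x \<in> W" and bi: "bitension g fubini_study f x = 0" and c: "c \<noteq> 0"
  shows "c\<^sup>2 \<le> (real CARD('m) + 3) / real CARD('m)"
proof -
  let ?m = "real CARD('m)"
  have m: "?m > 0" by simp
  have "?m\<^sup>2 * c\<^sup>2 \<le> ?m * (?m + 3)"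
    by (rule biharmonic_norm_bound(1)[OF x J_tau[OF x] bi norm_tau]) (use c in auto)
  then have "?m * (c\<^sup>2 * ?m) \<le> ?m * (?m + 3)" by (simp add: power2_eq_square mult_ac)
  then have "c\<^sup>2 * ?m \<le> ?m + 3" by (rule mult_left_le_imp_le) (rule m)
  then show ?thesis by (simp only: pos_le_divide_eq[OF m])
qed

lemma biharmonic_iff_at_extremal_curvature:
  assumes c: "c \<noteq> 0" "c\<^sup>2 = (real CARD('m) + 3) / real CARD('m)"
  shows "(\<forall>x\<in>W. bitension g fubini_study f x = 0) \<longleftrightarrow>
    (\<forall>x\<in>W. \<forall>u. weingarten fubini_study f (mean_curv fubini_study f) x u
        = (fs_norm (f x) (mean_curv fubini_study f x))\<^sup>2 *\<^sub>R df x u)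
    \<and> (\<forall>x\<in>W. \<forall>u. normal_connection fubini_study f (mean_curv fubini_study f) x u = 0)"
    (is "_ \<longleftrightarrow> ?umb \<and> ?par")
proof -
  let ?m = "real CARD('m)"
  have m: "?m > 0" by simp
  have mc: "?m * c\<^sup>2 = ?m + 3" unfolding c(2) by simp
  have "(?umb \<and> ?par) \<longleftrightarrow> (\<forall>x\<in>W. \<forall>u. nab (mean_curv fubini_study f) x u = - c\<^sup>2 *\<^sub>R df x u)"
    using umbilical_parallel_iff[of _ _ "c\<^sup>2"] cmc by (auto simp del: scaleR_minus_left)
  also have "\<dots> \<longleftrightarrow> (\<forall>x\<in>W. \<forall>u. nab tau x u = - (?m + 3) *\<^sub>R df x u)"
  proof (intro ball_cong refl all_cong1)
    fix x u assume x: "x \<in> W"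
    have "nab tau x u = ?m *\<^sub>R nab (mean_curv fubini_study f) x u"
      by (simp add: nab_mean_curv[OF x])
    moreover have "- (?m + 3) *\<^sub>R df x u = ?m *\<^sub>R (- c\<^sup>2 *\<^sub>R df x u)"
      unfolding mc[symmetric] by simp
    ultimately show "nab (mean_curv fubini_study f) x u = - c\<^sup>2 *\<^sub>R df x u 
        \<longleftrightarrow> nab tau x u = - (?m + 3) *\<^sub>R df x u"
      using m by (simp only: real_vector.scale_left_imp_eq scaleR_cancel_left) simp
  qed
  also have "\<dots> \<longleftrightarrow> (\<forall>x\<in>W. bitension g fubini_study f x = 0)"
  proof (intro iffI ballI allI)
    fix x assume "\<forall>x\<in>W. \<forall>u. nab tau x u = - (?m + 3) *\<^sub>R df x u" and x: "x \<in> W"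
    then show "bitension g fubini_study f x = 0" by (intro biharmonicI[OF x J_tau[OF x]]) blast
  next
    fix x u assume bi: "\<forall>x\<in>W. bitension g fubini_study f x = 0" and x: "x \<in> W"
    show "nab tau x u = - (?m + 3) *\<^sub>R df x u"
    proof (rule biharmonic_norm_bound(2)[OF x J_tau[OF x] bi[rule_format, OF x] norm_tau])
      show "?m\<^sup>2 * c\<^sup>2 = ?m * (?m + 3)" unfolding mc[symmetric] by (simp add: power2_eq_square)
    qed (use c(1) in auto)
  qed
  finally show ?thesis by blast
qed

lemma not_harmonic: "x \<in> W \<Longrightarrow> c \<noteq> 0 \<Longrightarrow> tau x \<noteq> 0"
  using norm_tau[of x] by (auto simp: fs_simps)

end

theorem proposition2p4:
  fixes M :: "'n::finite cp_point set"
    and A :: "('m::finite, 'n) cp_patch set"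
    and c :: real
  assumes "cp_submanifold M A"
    and "JH_tangent A"
    and "constant_mean_curvature A c"
    and "c \<noteq> 0"
  shows "(proper_biharmonic_submanifold A \<longrightarrow>
            c\<^sup>2 \<in> {0 <.. (real CARD('m) + 3) / real CARD('m)}) \<and>
         (c\<^sup>2 = (real CARD('m) + 3) / real CARD('m) \<longrightarrow>
            (proper_biharmonic_submanifold A \<longleftrightarrow>
              pseudo_umbilical A \<and> parallel_mean_curvature A))"
proof -
  have loc: "cmc_fs_immersion f W c" if "(W, f) \<in> inclusion_reps A" for W f
    using inclusion_rep_immersion[OF assms(1) that] assms(2,3) that
    unfolding cmc_fs_immersion_def cmc_fs_immersion_axioms_def JH_tangent_def constant_mean_curvature_def
    by blast
  obtain W0 f0 x0 where rep: "(W0, f0) \<in> inclusion_reps A" "x0 \<in> W0"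
    by (rule inclusion_rep_exists[OF assms(1)])
  have "\<not> harmonic_submanifold A"
    using cmc_fs_immersion.not_harmonic[OF loc[OF rep(1)] rep(2) assms(4)] rep
    unfolding harmonic_submanifold_def by blast
  then have proper: "proper_biharmonic_submanifold A \<longleftrightarrow> biharmonic_submanifold A"
    by (simp add: proper_biharmonic_submanifold_def)
  have "c\<^sup>2 \<le> (real CARD('m) + 3) / real CARD('m)" if "biharmonic_submanifold A"
    using that rep cmc_fs_immersion.mean_curvature_bound[OF loc[OF rep(1)] rep(2) _ assms(4)]
    unfolding biharmonic_submanifold_def by blast
  moreover have "biharmonic_submanifold A \<longleftrightarrow> pseudo_umbilical A \<and> parallel_mean_curvature A"
    if "c\<^sup>2 = (real CARD('m) + 3) / real CARD('m)"
    unfolding biharmonic_submanifold_def pseudo_umbilical_def parallel_mean_curvature_def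
      ball_conj_distrib[symmetric]
  proof (intro ball_cong refl)
    fix rep assume r: "rep \<in> inclusion_reps A"
    obtain W f where rep: "rep = (W, f)" by (cases rep)
    show "(case rep of (W, f) \<Rightarrow> \<forall>x\<in>W. bitension (induced_metric fubini_study f) fubini_study f x = 0) \<longleftrightarrow>
      (case rep of (W, f) \<Rightarrow> \<forall>x\<in>W. \<forall>u. weingarten fubini_study f (mean_curv fubini_study f) x u
          = (fs_norm (f x) (mean_curv fubini_study f x))\<^sup>2 *\<^sub>R dderiv f x u) \<and>
      (case rep of (W, f) \<Rightarrow> \<forall>x\<in>W. \<forall>u. normal_connection fubini_study f (mean_curv fubini_study f) x u = 0)"
      using cmc_fs_immersion.biharmonic_iff_at_extremal_curvature[OF loc[OF r[unfolded rep]] assms(4) that]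
      by (simp only: rep prod.case)
  qed
  ultimately show ?thesis using assms(4) by (simp add: proper)
qed

end
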